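(* Let $X=(X_t)_{t\in[0,T]}$ be a Gaussian process satisfying the standing assumption (A) of the context, with kernel $K$ and Brownian motion $W$. Let $$\Delta=[t_L^1,t_U^1]\cup\dots\cup[t_L^n,t_U^n],\qquad 0\le t_L^1<t_U^1<t_L^2<\dots<t_L^n<t_U^n\le T,$$ and $\mathcal{F}_\Delta=\sigma(X_t:t\in\Delta)$. Then for each $t\in[0,T]\setminus\Delta$, $$\hat X_t=\mathbb{E}[X_t\mid\mathcal{F}_\Delta]=\int_0^T f_t(s)\,dW_s,$$ where $f_t\in L^2([0,T])$ is the solution of the system of Fredholm integral equations $$\int_0^T f_t(s)K(u_k,s)\,ds=\int_0^T K(t,s)K(u_k,s)\,ds,\qquad k=1,\dots,n,\quad t_L^k\le u_k\le t_U^k,$$ that satisfies $$\int_0^T f_t(s)g(s)\,ds=0$$ for all $g\in L^2([0,T])$ such that $\int_0^T g(s)K(u_k,s)\,ds=0$ for all $k=1,\dots,n$ and all $t_L^k\le u_k\le t_U^k$.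
   Context: Standing assumption (A): $T>0$; $X=(X_t)_{t\in[0,T]}$ is a centered and separable Gaussian process on a probability space $(\Omega,\mathcal{F},\mathbb{P})$ with $\sup_{t\in[0,T]}\mathbb{E}[X_t^2]<\infty$; there exist a deterministic kernel $K\in L^2([0,T]^2)$ and a standard Brownian motion $W$ such that $X_t=\int_0^T K(t,s)\,dW_s$ holds exactly (almost surely, not merely in law) for every $t\in[0,T]$, where the integral is a Wiener integral (so $K(t,\cdot)\in L^2([0,T])$ for every $t$); and $H^X_T=H^W_T$. Here, for a process $Z$, $H^Z_t$ (the first chaos) denotes the closure in $L^2(\Omega)$ of the linear span of $\{Z_s:s\in[0,t]\}$. *)

theory Defs
  imports "HOL-Probability.Probability"
begin

text \<open>
  Elements of an \<open>L\<^sup>2\<close> space are represented by functions rather than by classes of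
  functions; all notions below respect equality almost everywhere. The space \<open>L\<^sup>2([0,T])\<close> is
  taken with respect to \<^term>\<open>lebesgue_on {0..T}\<close>.
\<close>

definition square_integrable :: "'a measure \<Rightarrow> ('a \<Rightarrow> real) \<Rightarrow> bool" where
  "square_integrable M f \<longleftrightarrow> f \<in> borel_measurable M \<and> integrable M (\<lambda>x. (f x)\<^sup>2)"

text \<open>
  The nonnegative integral is used because the Bochner integral of a non-integrable function is \<open>0\<close>.
\<close>

definition tendsto_L2 :: "'a measure \<Rightarrow> (nat \<Rightarrow> 'a \<Rightarrow> real) \<Rightarrow> ('a \<Rightarrow> real) \<Rightarrow> bool" where
  "tendsto_L2 M F f \<longleftrightarrow> (\<lambda>n. \<integral>\<^sup>+x. ennreal ((F n x - f x)\<^sup>2) \<partial>M) \<longlonglongrightarrow> 0"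

text \<open>Constants count as (degenerate) Gaussian random variables.\<close>

definition gaussian_rv :: "'a measure \<Rightarrow> ('a \<Rightarrow> real) \<Rightarrow> bool" where
  "gaussian_rv M Y \<longleftrightarrow> Y \<in> borel_measurable M \<and>
     ((\<exists>\<mu>. AE \<omega> in M. Y \<omega> = \<mu>) \<or>
      (\<exists>\<mu> \<sigma>. 0 < \<sigma> \<and> distributed M lborel Y (normal_density \<mu> \<sigma>)))"

definition linear_span :: "('t \<Rightarrow> 'a \<Rightarrow> real) \<Rightarrow> 't set \<Rightarrow> ('a \<Rightarrow> real) set" where
  "linear_span Z I = {Y. \<exists>J c. finite J \<and> J \<subseteq> I \<and> Y = (\<lambda>\<omega>. \<Sum>s\<in>J. c s * Z s \<omega>)}"

definition centered_gaussian_process :: "'a measure \<Rightarrow> 't set \<Rightarrow> ('t \<Rightarrow> 'a \<Rightarrow> real) \<Rightarrow> bool" where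
  "centered_gaussian_process M I X \<longleftrightarrow>
     (\<forall>Y\<in>linear_span X I. gaussian_rv M Y) \<and> (\<forall>t\<in>I. (\<integral>\<omega>. X t \<omega> \<partial>M) = 0)"

text \<open>
  Separability in the sense of Doob: outside one null set, the graph of each path is contained in
  the closure of its restriction to a fixed countable dense set of times.
\<close>

definition separable_process :: "'a measure \<Rightarrow> real set \<Rightarrow> (real \<Rightarrow> 'a \<Rightarrow> real) \<Rightarrow> bool" where
  "separable_process M I X \<longleftrightarrow>
     (\<exists>D. countable D \<and> D \<subseteq> I \<and> I \<subseteq> closure D \<and>
        (AE \<omega> in M. \<forall>t\<in>I. (t, X t \<omega>) \<in> closure ((\<lambda>s. (s, X s \<omega>)) ` D)))"

definition brownian_motion :: "'a measure \<Rightarrow> real \<Rightarrow> (real \<Rightarrow> 'a \<Rightarrow> real) \<Rightarrow> bool" where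
  "brownian_motion M T W \<longleftrightarrow>
     (\<forall>t\<in>{0..T}. W t \<in> borel_measurable M) \<and>
     (AE \<omega> in M. W 0 \<omega> = 0) \<and>
     (\<forall>s t. 0 \<le> s \<and> s < t \<and> t \<le> T \<longrightarrow>
        distributed M lborel (\<lambda>\<omega>. W t \<omega> - W s \<omega>) (normal_density 0 (sqrt (t - s)))) \<and>
     (\<forall>(n::nat) \<tau>. 0 \<le> \<tau> 0 \<and> (\<forall>i<n. \<tau> i < \<tau> (Suc i)) \<and> \<tau> n \<le> T \<longrightarrow>
        prob_space.indep_vars M (\<lambda>_. borel) (\<lambda>i \<omega>. W (\<tau> (Suc i)) \<omega> - W (\<tau> i) \<omega>) {..<n}) \<and>
     (AE \<omega> in M. continuous_on {0..T} (\<lambda>t. W t \<omega>))"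

text \<open>
  A list of triples \<open>(a, u, v)\<close> encodes the step function \<open>\<Sum> a 1\<^bsub>(u,v]\<^esub>\<close> on \<open>[0,T]\<close>; the
  intervals may overlap.
\<close>

definition step_lists :: "real \<Rightarrow> (real \<times> real \<times> real) list set" where
  "step_lists T = {xs. \<forall>(a, u, v)\<in>set xs. 0 \<le> u \<and> u \<le> v \<and> v \<le> T}"

definition step_fun :: "(real \<times> real \<times> real) list \<Rightarrow> real \<Rightarrow> real" where
  "step_fun xs s = (\<Sum>(a, u, v)\<leftarrow>xs. a * indicator {u<..v} s)"

definition step_wiener :: "(real \<Rightarrow> 'a \<Rightarrow> real) \<Rightarrow> (real \<times> real \<times> real) list \<Rightarrow> 'a \<Rightarrow> real" where
  "step_wiener W xs \<omega> = (\<Sum>(a, u, v)\<leftarrow>xs. a * (W v \<omega> - W u \<omega>))"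

text \<open>
  \<open>has_wiener_integral M T W f Y\<close> says that \<open>Y\<close> is a version of \<open>\<integral>\<^sub>0\<^sup>T f(s) dW\<^sub>s\<close>, the
  \<open>L\<^sup>2\<close>-continuous extension of the integral of step functions.
\<close>

definition has_wiener_integral ::
    "'a measure \<Rightarrow> real \<Rightarrow> (real \<Rightarrow> 'a \<Rightarrow> real) \<Rightarrow> (real \<Rightarrow> real) \<Rightarrow> ('a \<Rightarrow> real) \<Rightarrow> bool" where
  "has_wiener_integral M T W f Y \<longleftrightarrow>
     square_integrable (lebesgue_on {0..T}) f \<and> square_integrable M Y \<and>
     (\<exists>xs. (\<forall>n. xs n \<in> step_lists T) \<and>
        tendsto_L2 (lebesgue_on {0..T}) (\<lambda>n. step_fun (xs n)) f \<and>
        tendsto_L2 M (\<lambda>n. step_wiener W (xs n)) Y)"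

definition first_chaos :: "'a measure \<Rightarrow> (real \<Rightarrow> 'a \<Rightarrow> real) \<Rightarrow> real \<Rightarrow> ('a \<Rightarrow> real) set" where
  "first_chaos M Z t = {Y. square_integrable M Y \<and>
     (\<exists>F. (\<forall>n. F n \<in> linear_span Z {0..t}) \<and> tendsto_L2 M F Y)}"

definition sigma_generated :: "'a measure \<Rightarrow> ('t \<Rightarrow> 'a \<Rightarrow> real) \<Rightarrow> 't set \<Rightarrow> 'a measure" where
  "sigma_generated M X I = sigma (space M) (\<Union>t\<in>I. {X t -` A \<inter> space M | A. A \<in> sets borel})"

definition fredholm_solution ::
    "real \<Rightarrow> (real \<Rightarrow> real \<Rightarrow> real) \<Rightarrow> real set \<Rightarrow> real \<Rightarrow> (real \<Rightarrow> real) \<Rightarrow> bool" where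
  "fredholm_solution T K D t f \<longleftrightarrow>
     square_integrable (lebesgue_on {0..T}) f \<and>
     (\<forall>u\<in>D. (\<integral>s. f s * K u s \<partial>lebesgue_on {0..T}) = (\<integral>s. K t s * K u s \<partial>lebesgue_on {0..T}))"

definition orthogonal_to_kernel_complement ::
    "real \<Rightarrow> (real \<Rightarrow> real \<Rightarrow> real) \<Rightarrow> real set \<Rightarrow> (real \<Rightarrow> real) \<Rightarrow> bool" where
  "orthogonal_to_kernel_complement T K D f \<longleftrightarrow>
     (\<forall>g. square_integrable (lebesgue_on {0..T}) g \<and>
          (\<forall>u\<in>D. (\<integral>s. g s * K u s \<partial>lebesgue_on {0..T}) = 0) \<longrightarrow>
        (\<integral>s. f s * g s \<partial>lebesgue_on {0..T}) = 0)"

end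

theory Submission
  imports Defs
begin

text \<open>
  Let \<open>f\<close> be the orthogonal projection of \<open>K t\<close> onto the closed span of the functions \<open>K u\<close>,
  \<open>u \<in> \<Delta>\<close>. It solves the Fredholm system and is orthogonal to the complement of that span; the
  difference of two such solutions is orthogonal to itself, hence zero. By the isometry of the Wiener
  integral, \<open>V = \<integral> f dW\<close> is the \<open>L\<^sup>2\<close>-limit of linear combinations of the \<open>X u\<close>, so it has an
  \<open>\<F>\<^sub>\<Delta>\<close>-measurable version, and \<open>Z = X t - V\<close> is uncorrelated with every \<open>X u\<close>. Since \<open>Z\<close> and the
  linear combinations \<open>L\<close> of the \<open>X u\<close> are jointly Gaussian, \<open>\<E> Z e\<^bsup>iL\<^esup> = 0\<close>. Replacing the factors
  \<open>e\<^bsup>isX u\<^esup>\<close> one at a time by indicators, with the one-dimensional uniqueness theorem, extends this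
  to \<open>\<E> Z 1\<^sub>A = 0\<close> for all \<open>A \<in> \<F>\<^sub>\<Delta>\<close>, which means \<open>\<E>[X t | \<F>\<^sub>\<Delta>] = V\<close>.
\<close>

subsection \<open>The seminorm of square-integrable functions\<close>

text \<open>The geometry is done with a seminorm on functions, and both limits, f and V, come from
  completeness of \<open>L\<^sup>2\<close> over a finite measure. For V that measure is the
  restriction of the probability to \<open>\<F>\<^sub>\<Delta>\<close>, which makes V measurable by
  construction.

  The obstacle is that the Gaussian hypothesis speaks of finite linear combinations only, while Z
  contains the limit V. What is carried to the limit is therefore the formula for the characteristic
  function, and this is enough: if L and Z are uncorrelated, the exponent of E exp(i(L + bZ)) =
  exp(-(E L^2 + b^2 E Z^2)/2) has no term linear in b, whereas the derivative at b = 0 is i E Z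
  exp(iL).

  After that, Z is read as the density of a signed measure that annihilates all trigonometric
  functions of the span. A uniqueness theorem on the line reaches sets of several coordinates
  because the coordinates already treated are absorbed into the density, and the cylinder sets
  obtained in this way are stable under intersection and generate
  \<open>\<F>\<^sub>\<Delta>\<close>.\<close>

definition inner_L2 :: "'a measure \<Rightarrow> ('a \<Rightarrow> real) \<Rightarrow> ('a \<Rightarrow> real) \<Rightarrow> real" where
  "inner_L2 M f g = (\<integral>x. f x * g x \<partial>M)"

definition norm_L2 :: "'a measure \<Rightarrow> ('a \<Rightarrow> real) \<Rightarrow> real" where
  "norm_L2 M f = sqrt (inner_L2 M f f)"

lemma square_integrable_measurable: "square_integrable M f \<Longrightarrow> f \<in> borel_measurable M"
  by (simp add: square_integrable_def)

lemma square_integrable_mult: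
  assumes "square_integrable M f" "square_integrable M g"
  shows "integrable M (\<lambda>x. f x * g x)"
proof (rule Bochner_Integration.integrable_bound)
  show "integrable M (\<lambda>x. (f x)\<^sup>2 + (g x)\<^sup>2)"
    using assms by (auto simp: square_integrable_def)
  show "(\<lambda>x. f x * g x) \<in> borel_measurable M"
    using assms by (auto simp: square_integrable_def)
  have "\<bar>a * b\<bar> \<le> a\<^sup>2 + b\<^sup>2" for a b :: real
  proof -
    have "2 * \<bar>a * b\<bar> \<le> a\<^sup>2 + b\<^sup>2"
      using sum_squares_bound[of "\<bar>a\<bar>" "\<bar>b\<bar>"] by (simp add: abs_mult)
    then show ?thesis using abs_ge_zero[of "a * b"] by linarith
  qed
  then show "AE x in M. norm (f x * g x) \<le> norm ((f x)\<^sup>2 + (g x)\<^sup>2)"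
    by simp
qed

lemma square_integrable_add:
  assumes "square_integrable M f" "square_integrable M g"
  shows "square_integrable M (\<lambda>x. f x + g x)"
  using assms square_integrable_mult[OF assms]
  by (auto simp: square_integrable_def power2_sum mult.assoc)

lemma square_integrable_cmult:
  "square_integrable M f \<Longrightarrow> square_integrable M (\<lambda>x. c * f x)"
  by (auto simp: square_integrable_def power_mult_distrib)

lemma square_integrable_diff:
  assumes "square_integrable M f" "square_integrable M g"
  shows "square_integrable M (\<lambda>x. f x - g x)"
  using square_integrable_add[OF assms(1) square_integrable_cmult[OF assms(2), of "-1"]] by simp

lemma square_integrable_zero: "square_integrable M (\<lambda>x. 0)"
  by (simp add: square_integrable_def)

lemma square_integrable_sum:
  "(\<And>i. i \<in> I \<Longrightarrow> square_integrable M (f i)) \<Longrightarrow> square_integrable M (\<lambda>x. \<Sum>i\<in>I. f i x)"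
  by (induction I rule: infinite_finite_induct)
     (auto intro: square_integrable_add square_integrable_zero)

lemma inner_L2_commute: "inner_L2 M f g = inner_L2 M g f"
  by (simp add: inner_L2_def mult.commute)

lemma inner_L2_add_left:
  assumes "square_integrable M f" "square_integrable M g" "square_integrable M h"
  shows "inner_L2 M (\<lambda>x. f x + g x) h = inner_L2 M f h + inner_L2 M g h"
  using assms by (simp add: inner_L2_def distrib_right square_integrable_mult)

lemma inner_L2_diff_left:
  assumes "square_integrable M f" "square_integrable M g" "square_integrable M h"
  shows "inner_L2 M (\<lambda>x. f x - g x) h = inner_L2 M f h - inner_L2 M g h"
  using assms by (simp add: inner_L2_def left_diff_distrib square_integrable_mult)

text \<open>If the product is not integrable, both sides are 0 by the default value of the Bochner
  integral.\<close>

lemma inner_L2_cmult_left: "inner_L2 M (\<lambda>x. c * f x) g = c * inner_L2 M f g"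
  by (simp add: inner_L2_def mult.assoc)

lemma inner_L2_add_right:
  assumes "square_integrable M f" "square_integrable M g" "square_integrable M h"
  shows "inner_L2 M h (\<lambda>x. f x + g x) = inner_L2 M h f + inner_L2 M h g"
  using inner_L2_add_left[OF assms] by (simp add: inner_L2_commute)

lemma inner_L2_cmult_right: "inner_L2 M g (\<lambda>x. c * f x) = c * inner_L2 M g f"
  using inner_L2_cmult_left by (simp add: inner_L2_commute)

lemma inner_L2_sum_left:
  assumes "\<And>i. i \<in> I \<Longrightarrow> square_integrable M (f i)" "square_integrable M g"
  shows "inner_L2 M (\<lambda>x. \<Sum>i\<in>I. f i x) g = (\<Sum>i\<in>I. inner_L2 M (f i) g)"
  using assms by (simp add: inner_L2_def sum_distrib_right square_integrable_mult)

lemma inner_L2_self_nonneg: "0 \<le> inner_L2 M f f"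
  by (simp add: inner_L2_def)

lemma norm_L2_nonneg: "0 \<le> norm_L2 M f"
  by (simp add: norm_L2_def inner_L2_self_nonneg)

lemma norm_L2_power2: "(norm_L2 M f)\<^sup>2 = inner_L2 M f f"
  by (simp add: norm_L2_def inner_L2_self_nonneg)

lemma norm_L2_cmult: "norm_L2 M (\<lambda>x. c * f x) = \<bar>c\<bar> * norm_L2 M f"
  by (simp add: norm_L2_def inner_L2_cmult_left inner_L2_cmult_right real_sqrt_mult
      flip: mult.assoc)

lemma norm_L2_minus_commute: "norm_L2 M (\<lambda>x. f x - g x) = norm_L2 M (\<lambda>x. g x - f x)"
  by (simp add: norm_L2_def inner_L2_def power2_commute flip: power2_eq_square)

lemma norm_L2_add_power2:
  assumes "square_integrable M f" "square_integrable M g"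
  shows "(norm_L2 M (\<lambda>x. f x + g x))\<^sup>2 = (norm_L2 M f)\<^sup>2 + 2 * inner_L2 M f g + (norm_L2 M g)\<^sup>2"
  using assms inner_L2_commute[of M g f]
  by (simp add: norm_L2_power2 inner_L2_add_left inner_L2_add_right square_integrable_add)

lemma Cauchy_Schwarz_L2:
  assumes f: "square_integrable M f" and g: "square_integrable M g"
  shows "\<bar>inner_L2 M f g\<bar> \<le> norm_L2 M f * norm_L2 M g"
proof -
  define a b c where "a = inner_L2 M f f" and "b = inner_L2 M f g" and "c = inner_L2 M g g"
  have pos: "0 \<le> x\<^sup>2 * a + 2 * x * b + c" for x
  proof -
    have "0 \<le> (norm_L2 M (\<lambda>s. x * f s + g s))\<^sup>2"
      by simp
    also have "\<dots> = x\<^sup>2 * a + 2 * x * b + c"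
      by (subst norm_L2_add_power2)
         (use f g in \<open>simp_all add: square_integrable_cmult norm_L2_power2 inner_L2_cmult_left
            inner_L2_cmult_right a_def b_def c_def power2_eq_square[of x]\<close>)
    finally show ?thesis .
  qed
  have "0 \<le> a" "0 \<le> c"
    by (auto simp: a_def c_def inner_L2_self_nonneg)
  have "b\<^sup>2 \<le> a * c"
  proof (cases "a = 0")
    case True
    have "b = 0"
    proof (rule ccontr)
      assume "b \<noteq> 0"
      then show False
        using pos[of "- (c + 1) / (2 * b)"] True by (simp add: field_simps)
    qed
    then show ?thesis using True by simp
  next
    case False
    then have "0 < a" using \<open>0 \<le> a\<close> by simp
    \<comment> \<open>The point -b/a minimizes the quadratic; the factor a clears the denominator of
      the minimum.\<close>
    then have "0 \<le> a * ((- b / a)\<^sup>2 * a + 2 * (- b / a) * b + c)"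
      using pos[of "- b / a"] by (intro mult_nonneg_nonneg) auto
    also have "\<dots> = a * c - b\<^sup>2"
      using False by (simp add: power2_eq_square field_simps)
    finally show ?thesis by simp
  qed
  then have "sqrt (b\<^sup>2) \<le> sqrt (a * c)"
    by (rule real_sqrt_le_mono)
  then show ?thesis
    by (simp add: norm_L2_def real_sqrt_mult a_def b_def c_def)
qed

lemma norm_L2_triangle:
  assumes "square_integrable M f" "square_integrable M g"
  shows "norm_L2 M (\<lambda>x. f x + g x) \<le> norm_L2 M f + norm_L2 M g"
proof (rule power2_le_imp_le)
  have "inner_L2 M f g \<le> norm_L2 M f * norm_L2 M g"
    using Cauchy_Schwarz_L2[OF assms] by simp
  then show "(norm_L2 M (\<lambda>x. f x + g x))\<^sup>2 \<le> (norm_L2 M f + norm_L2 M g)\<^sup>2"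
    by (simp add: norm_L2_add_power2[OF assms] power2_sum)
qed (simp add: norm_L2_nonneg)

lemma norm_L2_triangle_diff:
  assumes "square_integrable M f" "square_integrable M g" "square_integrable M h"
  shows "norm_L2 M (\<lambda>x. f x - h x) \<le> norm_L2 M (\<lambda>x. f x - g x) + norm_L2 M (\<lambda>x. g x - h x)"
  using norm_L2_triangle[of M "\<lambda>x. f x - g x" "\<lambda>x. g x - h x"] assms
  by (simp add: square_integrable_diff)

lemma norm_L2_reverse_triangle:
  assumes "square_integrable M f" "square_integrable M g"
  shows "\<bar>norm_L2 M f - norm_L2 M g\<bar> \<le> norm_L2 M (\<lambda>x. f x - g x)"
  using norm_L2_triangle_diff[of M f g "\<lambda>_. 0"] norm_L2_triangle_diff[of M g f "\<lambda>_. 0"] assms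
    norm_L2_minus_commute[of M f g]
  by (simp add: square_integrable_zero)

lemma inner_L2_self_eq_0_AE:
  assumes "square_integrable M f" "inner_L2 M f f = 0"
  shows "AE x in M. f x = 0"
proof -
  have "AE x in M. (f x)\<^sup>2 = 0"
    using assms integral_nonneg_eq_0_iff_AE[of M "\<lambda>x. (f x)\<^sup>2"]
    by (simp add: square_integrable_def inner_L2_def power2_eq_square)
  then show ?thesis by simp
qed

section \<open>Mean-square convergence in terms of the seminorm\<close>

lemma nn_integral_power2_eq_norm_L2:
  assumes "square_integrable M f"
  shows "(\<integral>\<^sup>+x. ennreal ((f x)\<^sup>2) \<partial>M) = ennreal ((norm_L2 M f)\<^sup>2)"
  using assms
  by (simp add: square_integrable_def nn_integral_eq_integral norm_L2_power2 inner_L2_def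
      flip: power2_eq_square)

text \<open>For square-integrable functions the nonnegative integral is the finite number
  \<open>(norm_L2 M f)\<^sup>2\<close>, so the definition by \<open>ennreal\<close> values and the
  seminorm agree up to a square root.\<close>

lemma tendsto_L2_iff:
  assumes "\<And>n. square_integrable M (F n)" "square_integrable M f"
  shows "tendsto_L2 M F f \<longleftrightarrow> (\<lambda>n. norm_L2 M (\<lambda>x. F n x - f x)) \<longlonglongrightarrow> 0"
proof -
  have "tendsto_L2 M F f \<longleftrightarrow> (\<lambda>n. ennreal ((norm_L2 M (\<lambda>x. F n x - f x))\<^sup>2)) \<longlonglongrightarrow> ennreal 0"
    using assms
    by (simp add: tendsto_L2_def nn_integral_power2_eq_norm_L2 square_integrable_diff)
  also have "\<dots> \<longleftrightarrow> (\<lambda>n. (norm_L2 M (\<lambda>x. F n x - f x))\<^sup>2) \<longlonglongrightarrow> 0"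
    by (intro tendsto_ennreal_iff) auto
  also have "\<dots> \<longleftrightarrow> (\<lambda>n. norm_L2 M (\<lambda>x. F n x - f x)) \<longlonglongrightarrow> 0"
  proof
    assume "(\<lambda>n. (norm_L2 M (\<lambda>x. F n x - f x))\<^sup>2) \<longlonglongrightarrow> 0"
    from tendsto_real_sqrt[OF this] show "(\<lambda>n. norm_L2 M (\<lambda>x. F n x - f x)) \<longlonglongrightarrow> 0"
      by (simp add: norm_L2_nonneg)
  qed (auto dest: tendsto_power[where n = 2])
  finally show ?thesis .
qed

lemma norm_L2_tendsto:
  assumes "\<And>n. square_integrable M (F n)" "square_integrable M f" "tendsto_L2 M F f"
  shows "(\<lambda>n. norm_L2 M (F n)) \<longlonglongrightarrow> norm_L2 M f"
proof -
  have "(\<lambda>n. norm_L2 M (F n) - norm_L2 M f) \<longlonglongrightarrow> 0"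
  proof (rule Lim_null_comparison)
    show "(\<lambda>n. norm_L2 M (\<lambda>x. F n x - f x)) \<longlonglongrightarrow> 0"
      using assms tendsto_L2_iff[of M F f] by simp
    show "\<forall>\<^sub>F n in sequentially. norm (norm_L2 M (F n) - norm_L2 M f) \<le> norm_L2 M (\<lambda>x. F n x - f x)"
      using assms norm_L2_reverse_triangle[of M] by simp
  qed
  then show ?thesis by (simp add: LIM_zero_cancel)
qed

lemma inner_L2_tendsto:
  assumes "\<And>n. square_integrable M (F n)" "square_integrable M f" "tendsto_L2 M F f"
    and g: "square_integrable M g"
  shows "(\<lambda>n. inner_L2 M (F n) g) \<longlonglongrightarrow> inner_L2 M f g"
proof -
  have "(\<lambda>n. inner_L2 M (F n) g - inner_L2 M f g) \<longlonglongrightarrow> 0"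
  proof (rule Lim_null_comparison)
    show "(\<lambda>n. norm_L2 M (\<lambda>x. F n x - f x) * norm_L2 M g) \<longlonglongrightarrow> 0"
      using assms tendsto_L2_iff[of M F f] by (auto intro: tendsto_mult_left_zero)
    show "\<forall>\<^sub>F n in sequentially. norm (inner_L2 M (F n) g - inner_L2 M f g)
        \<le> norm_L2 M (\<lambda>x. F n x - f x) * norm_L2 M g"
      using assms Cauchy_Schwarz_L2[OF square_integrable_diff g]
      by (simp add: inner_L2_diff_left)
  qed
  then show ?thesis by (simp add: LIM_zero_cancel)
qed

lemma tendsto_L2_add:
  assumes "\<And>n. square_integrable M (F n)" "square_integrable M f" "tendsto_L2 M F f"
    and "\<And>n. square_integrable M (G n)" "square_integrable M g" "tendsto_L2 M G g"
  shows "tendsto_L2 M (\<lambda>n x. F n x + G n x) (\<lambda>x. f x + g x)"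
proof -
  have "(\<lambda>n. norm_L2 M (\<lambda>x. F n x + G n x - (f x + g x))) \<longlonglongrightarrow> 0"
  proof (rule Lim_null_comparison)
    show "(\<lambda>n. norm_L2 M (\<lambda>x. F n x - f x) + norm_L2 M (\<lambda>x. G n x - g x)) \<longlonglongrightarrow> 0"
      using assms tendsto_L2_iff[of M F f] tendsto_L2_iff[of M G g] by (auto intro: tendsto_add_zero)
    have "norm_L2 M (\<lambda>x. F n x + G n x - (f x + g x))
        \<le> norm_L2 M (\<lambda>x. F n x - f x) + norm_L2 M (\<lambda>x. G n x - g x)" for n
      using norm_L2_triangle[of M "\<lambda>x. F n x - f x" "\<lambda>x. G n x - g x"] assms
      by (simp add: square_integrable_diff algebra_simps)
    then show "\<forall>\<^sub>F n in sequentially. norm (norm_L2 M (\<lambda>x. F n x + G n x - (f x + g x)))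
        \<le> norm_L2 M (\<lambda>x. F n x - f x) + norm_L2 M (\<lambda>x. G n x - g x)"
      by (simp add: norm_L2_nonneg)
  qed
  then show ?thesis
    using assms by (subst tendsto_L2_iff) (auto intro: square_integrable_add)
qed

lemma tendsto_L2_cmult:
  assumes "\<And>n. square_integrable M (F n)" "square_integrable M f" "tendsto_L2 M F f"
  shows "tendsto_L2 M (\<lambda>n x. c * F n x) (\<lambda>x. c * f x)"
proof -
  have "(\<lambda>n. \<bar>c\<bar> * norm_L2 M (\<lambda>x. F n x - f x)) \<longlonglongrightarrow> 0"
    using assms tendsto_L2_iff[of M F f] by (auto intro: tendsto_mult_right_zero)
  then have "(\<lambda>n. norm_L2 M (\<lambda>x. c * F n x - c * f x)) \<longlonglongrightarrow> 0"
    by (simp add: norm_L2_cmult flip: right_diff_distrib)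
  then show ?thesis
    using assms by (subst tendsto_L2_iff) (auto intro: square_integrable_cmult)
qed

lemma tendsto_L2_const: "tendsto_L2 M (\<lambda>n. f) f"
  by (simp add: tendsto_L2_def)

section \<open>Finite measures and completeness\<close>

lemma (in finite_measure) square_integrable_integrable:
  assumes "square_integrable M f"
  shows "integrable M f"
proof -
  have "square_integrable M (\<lambda>_. 1)"
    by (simp add: square_integrable_def)
  from square_integrable_mult[OF assms this] show ?thesis by simp
qed

text \<open>Cauchy-Schwarz against the constant 1, which is square integrable because the measure is
  finite. It turns mean-square estimates into estimates of expectations.\<close>

lemma (in finite_measure) integral_abs_le_norm_L2:
  assumes "square_integrable M f"
  shows "(\<integral>x. \<bar>f x\<bar> \<partial>M) \<le> norm_L2 M f * sqrt (measure M (space M))"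
proof -
  have "square_integrable M (\<lambda>x. \<bar>f x\<bar>)" "square_integrable M (\<lambda>_. 1)"
    using assms by (auto simp: square_integrable_def)
  from Cauchy_Schwarz_L2[OF this] show ?thesis
    by (simp add: norm_L2_def inner_L2_def)
qed

text \<open>Over a finite measure a Cauchy sequence in mean square is Cauchy in mean, so a
  subsequence converges almost everywhere. Fatou's lemma along that subsequence shows that the
  pointwise limit is also the mean-square limit of the whole sequence.\<close>

lemma (in finite_measure) Riesz_Fischer:
  assumes si: "\<And>n. square_integrable M (F n)"
    and cauchy: "\<And>e. 0 < e \<Longrightarrow> \<exists>N. \<forall>i\<ge>N. \<forall>j\<ge>N. norm_L2 M (\<lambda>x. F i x - F j x) < e"
  obtains f where "square_integrable M f" "tendsto_L2 M F f"
proof -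
  have [measurable]: "F n \<in> borel_measurable M" for n
    using si by (simp add: square_integrable_measurable)
  define C where "C = sqrt (measure M (space M))"
  have "0 \<le> C" by (simp add: C_def)
  have "\<exists>N. \<forall>i\<ge>N. \<forall>j\<ge>N. (\<integral>x. norm (F i x - F j x) \<partial>M) < e" if "0 < e" for e
  proof -
    obtain N where N: "\<And>i j. i \<ge> N \<Longrightarrow> j \<ge> N \<Longrightarrow> norm_L2 M (\<lambda>x. F i x - F j x) < e / (C + 1)"
      using cauchy[of "e / (C + 1)"] \<open>0 < e\<close> \<open>0 \<le> C\<close> by fastforce
    show ?thesis
    proof (intro exI allI impI)
      fix i j assume "N \<le> i" "N \<le> j"
      have "(\<integral>x. norm (F i x - F j x) \<partial>M) \<le> norm_L2 M (\<lambda>x. F i x - F j x) * C"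
        using integral_abs_le_norm_L2[OF square_integrable_diff[OF si si]] by (simp add: C_def)
      also have "\<dots> \<le> norm_L2 M (\<lambda>x. F i x - F j x) * (C + 1)"
        by (intro mult_left_mono norm_L2_nonneg) simp
      also have "\<dots> < e"
        using N[OF \<open>N \<le> i\<close> \<open>N \<le> j\<close>] \<open>0 \<le> C\<close> by (simp add: pos_less_divide_eq)
      finally show "(\<integral>x. norm (F i x - F j x) \<partial>M) < e" .
    qed
  qed
  then obtain r :: "nat \<Rightarrow> nat" where r: "strict_mono r" "AE x in M. Cauchy (\<lambda>i. F (r i) x)"
    using cauchy_L1_AE_cauchy_subseq[of M F, OF square_integrable_integrable[OF si]] by blast
  define f where "f x = lim (\<lambda>i. F (r i) x)" for x
  have [measurable]: "f \<in> borel_measurable M"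
    unfolding f_def by measurable
  have lim: "AE x in M. (\<lambda>i. F (r i) x) \<longlonglongrightarrow> f x"
    using r(2) by (auto simp: f_def Cauchy_convergent_iff convergent_LIMSEQ_iff)
  \<comment> \<open>The nonnegative integral is used here because f is not yet known to be square
    integrable.\<close>
  have fatou: "\<exists>N. \<forall>n\<ge>N. (\<integral>\<^sup>+x. ennreal ((F n x - f x)\<^sup>2) \<partial>M) \<le> ennreal (e\<^sup>2)" if "0 < e" for e
  proof -
    obtain N where N: "\<And>i j. i \<ge> N \<Longrightarrow> j \<ge> N \<Longrightarrow> norm_L2 M (\<lambda>x. F i x - F j x) < e"
      using cauchy[OF \<open>0 < e\<close>] by auto
    show ?thesis
    proof (intro exI allI impI)
      fix n assume "N \<le> n"
      have "(\<integral>\<^sup>+x. ennreal ((F n x - f x)\<^sup>2) \<partial>M)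
          = (\<integral>\<^sup>+x. liminf (\<lambda>i. ennreal ((F n x - F (r i) x)\<^sup>2)) \<partial>M)"
      proof (rule nn_integral_cong_AE, use lim in eventually_elim)
        fix x assume "(\<lambda>i. F (r i) x) \<longlonglongrightarrow> f x"
        then have "(\<lambda>i. ennreal ((F n x - F (r i) x)\<^sup>2)) \<longlonglongrightarrow> ennreal ((F n x - f x)\<^sup>2)"
          by (intro tendsto_ennrealI tendsto_intros)
        then show "ennreal ((F n x - f x)\<^sup>2) = liminf (\<lambda>i. ennreal ((F n x - F (r i) x)\<^sup>2))"
          by (rule lim_imp_Liminf[OF sequentially_bot, symmetric])
      qed
      also have "\<dots> \<le> liminf (\<lambda>i. \<integral>\<^sup>+x. ennreal ((F n x - F (r i) x)\<^sup>2) \<partial>M)"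
        by (rule nn_integral_liminf) measurable
      also have "\<dots> \<le> liminf (\<lambda>i. ennreal (e\<^sup>2))"
      proof (intro Liminf_mono eventually_sequentiallyI[of N])
        fix i assume "N \<le> i"
        then have "N \<le> r i" using seq_suble[OF r(1), of i] by simp
        then have "(norm_L2 M (\<lambda>x. F n x - F (r i) x))\<^sup>2 \<le> e\<^sup>2"
          using N[OF \<open>N \<le> n\<close>, of "r i"] by (intro power_mono norm_L2_nonneg) simp
        then show "(\<integral>\<^sup>+x. ennreal ((F n x - F (r i) x)\<^sup>2) \<partial>M) \<le> ennreal (e\<^sup>2)"
          by (subst nn_integral_power2_eq_norm_L2) (auto intro: square_integrable_diff si ennreal_leI)
      qed
      also have "\<dots> = ennreal (e\<^sup>2)"
        by (simp add: Liminf_const)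
      finally show "(\<integral>\<^sup>+x. ennreal ((F n x - f x)\<^sup>2) \<partial>M) \<le> ennreal (e\<^sup>2)" .
    qed
  qed
  \<comment> \<open>One finite distance suffices: f is the difference of F N and F N - f, both
    square integrable.\<close>
  obtain N where "(\<integral>\<^sup>+x. ennreal ((F N x - f x)\<^sup>2) \<partial>M) \<le> ennreal 1"
    using fatou[of 1] by auto
  then have "square_integrable M (\<lambda>x. F N x - f x)"
    by (auto simp: square_integrable_def integrable_iff_bounded intro: le_less_trans)
  from square_integrable_diff[OF si[of N] this] have f: "square_integrable M f"
    by simp
  moreover have "tendsto_L2 M F f"
  proof (subst tendsto_L2_iff)
    show "(\<lambda>n. norm_L2 M (\<lambda>x. F n x - f x)) \<longlonglongrightarrow> 0"
    proof (rule LIMSEQ_I)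
      fix e :: real assume "0 < e"
      obtain N where N: "\<And>n. n \<ge> N \<Longrightarrow> (\<integral>\<^sup>+x. ennreal ((F n x - f x)\<^sup>2) \<partial>M) \<le> ennreal ((e / 2)\<^sup>2)"
        using fatou[of "e / 2"] \<open>0 < e\<close> by auto
      have "norm_L2 M (\<lambda>x. F n x - f x) < e" if "n \<ge> N" for n
      proof -
        have "(norm_L2 M (\<lambda>x. F n x - f x))\<^sup>2 \<le> (e / 2)\<^sup>2"
          using N[OF that] nn_integral_power2_eq_norm_L2[OF square_integrable_diff[OF si f]]
          by (simp add: ennreal_le_iff)
        then have "norm_L2 M (\<lambda>x. F n x - f x) \<le> e / 2"
          by (rule power2_le_imp_le) (use \<open>0 < e\<close> in simp)
        then show ?thesis using \<open>0 < e\<close> by simp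
      qed
      then show "\<exists>N. \<forall>n\<ge>N. norm (norm_L2 M (\<lambda>x. F n x - f x) - 0) < e"
        by (intro exI[of _ N]) (simp add: norm_L2_nonneg)
    qed
  qed (use si f in auto)
  ultimately show ?thesis by (rule that)
qed

lemma tendsto_L2_imp_Cauchy:
  assumes si: "\<And>n. square_integrable M (F n)" "square_integrable M f" and "tendsto_L2 M F f" "0 < e"
  shows "\<exists>N. \<forall>i\<ge>N. \<forall>j\<ge>N. norm_L2 M (\<lambda>x. F i x - F j x) < e"
proof -
  have "(\<lambda>n. norm_L2 M (\<lambda>x. F n x - f x)) \<longlonglongrightarrow> 0"
    using assms tendsto_L2_iff[of M F f] by simp
  then obtain N where N: "\<And>n. n \<ge> N \<Longrightarrow> norm_L2 M (\<lambda>x. F n x - f x) < e / 2"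
    using \<open>0 < e\<close> by (fastforce simp: norm_L2_nonneg dest!: LIMSEQ_D[of _ _ "e / 2"])
  have "norm_L2 M (\<lambda>x. F i x - F j x) < e" if "i \<ge> N" "j \<ge> N" for i j
    using norm_L2_triangle_diff[OF si(1) si(2) si(1), of i j] N[OF that(1)] N[OF that(2)]
      norm_L2_minus_commute[of M f "F j"] by simp
  then show ?thesis by blast
qed

section \<open>Finite linear combinations\<close>

lemma linear_span_add:
  assumes "Y \<in> linear_span Z I" "Y' \<in> linear_span Z I"
  shows "(\<lambda>\<omega>. Y \<omega> + Y' \<omega>) \<in> linear_span Z I"
proof -
  obtain J c J' c' where J: "finite J" "J \<subseteq> I" "Y = (\<lambda>\<omega>. \<Sum>s\<in>J. c s * Z s \<omega>)"
    and J': "finite J'" "J' \<subseteq> I" "Y' = (\<lambda>\<omega>. \<Sum>s\<in>J'. c' s * Z s \<omega>)"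
    using assms by (auto simp: linear_span_def)
  \<comment> \<open>Both combinations are rewritten over the union of their index sets, with
    coefficient 0 outside their own; on the overlap the coefficients add up.\<close>
  define b where "b s = (if s \<in> J then c s else 0) + (if s \<in> J' then c' s else 0)" for s
  have "Y \<omega> + Y' \<omega> = (\<Sum>s\<in>J \<union> J'. b s * Z s \<omega>)" for \<omega>
  proof -
    have "Y \<omega> = (\<Sum>s\<in>J \<union> J'. (if s \<in> J then c s else 0) * Z s \<omega>)"
      unfolding J(3) by (rule sum.mono_neutral_cong_left) (use J J' in auto)
    moreover have "Y' \<omega> = (\<Sum>s\<in>J \<union> J'. (if s \<in> J' then c' s else 0) * Z s \<omega>)"
      unfolding J'(3) by (rule sum.mono_neutral_cong_left) (use J J' in auto)
    ultimately show ?thesis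
      by (simp add: b_def distrib_right sum.distrib)
  qed
  then show ?thesis
    unfolding linear_span_def using J J' by (intro CollectI exI[of _ "J \<union> J'"] exI[of _ b]) auto
qed

lemma linear_span_cmult:
  assumes "Y \<in> linear_span Z I"
  shows "(\<lambda>\<omega>. a * Y \<omega>) \<in> linear_span Z I"
proof -
  obtain J c where J: "finite J" "J \<subseteq> I" "Y = (\<lambda>\<omega>. \<Sum>s\<in>J. c s * Z s \<omega>)"
    using assms by (auto simp: linear_span_def)
  then show ?thesis
    unfolding linear_span_def
    by (intro CollectI exI[of _ J] exI[of _ "\<lambda>s. a * c s"]) (simp add: sum_distrib_left mult.assoc)
qed

lemma linear_span_base: "s \<in> I \<Longrightarrow> Z s \<in> linear_span Z I"
  unfolding linear_span_def by (intro CollectI exI[of _ "{s}"] exI[of _ "\<lambda>_. 1"]) auto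

lemma linear_span_zero: "(\<lambda>\<omega>. 0) \<in> linear_span Z I"
  unfolding linear_span_def by (intro CollectI exI[of _ "{}"]) auto

lemma linear_span_mono: "I \<subseteq> I' \<Longrightarrow> linear_span Z I \<subseteq> linear_span Z I'"
  unfolding linear_span_def by blast

lemma square_integrable_linear_span:
  assumes "\<And>s. s \<in> I \<Longrightarrow> square_integrable M (Z s)" "Y \<in> linear_span Z I"
  shows "square_integrable M Y"
proof -
  obtain J c where "finite J" "J \<subseteq> I" and Y: "Y = (\<lambda>\<omega>. \<Sum>s\<in>J. c s * Z s \<omega>)"
    using assms(2) by (auto simp: linear_span_def)
  then show ?thesis
    unfolding Y using assms(1) by (intro square_integrable_sum square_integrable_cmult) auto
qed

lemma borel_measurable_linear_span:
  assumes "\<And>t. t \<in> D \<Longrightarrow> X t \<in> borel_measurable N" "L \<in> linear_span X D"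
  shows "L \<in> borel_measurable N"
  using assms by (auto simp: linear_span_def intro!: borel_measurable_sum borel_measurable_times)

text \<open>Serves diagonal choices, where G n is picked close to F n and the F n converge.\<close>

lemma tendsto_L2_close:
  assumes F: "\<And>n. square_integrable M (F n)" "square_integrable M f" "tendsto_L2 M F f"
    and G: "\<And>n. square_integrable M (G n)" "\<And>n. norm_L2 M (\<lambda>x. G n x - F n x) < 1 / Suc n"
  shows "tendsto_L2 M G f"
proof (subst tendsto_L2_iff)
  show "(\<lambda>n. norm_L2 M (\<lambda>x. G n x - f x)) \<longlonglongrightarrow> 0"
  proof (rule Lim_null_comparison)
    show "(\<lambda>n. 1 / real (Suc n) + norm_L2 M (\<lambda>x. F n x - f x)) \<longlonglongrightarrow> 0"
      using F tendsto_L2_iff[of M F f] LIMSEQ_inverse_real_of_nat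
      by (intro tendsto_add_zero) (simp_all add: inverse_eq_divide)
    have "norm_L2 M (\<lambda>x. G n x - f x) \<le> 1 / real (Suc n) + norm_L2 M (\<lambda>x. F n x - f x)" for n
      using norm_L2_triangle_diff[OF G(1)[of n] F(1)[of n] F(2)] G(2)[of n] by linarith
    then show "\<forall>\<^sub>F n in sequentially.
        norm (norm_L2 M (\<lambda>x. G n x - f x)) \<le> 1 / real (Suc n) + norm_L2 M (\<lambda>x. F n x - f x)"
      by (simp add: norm_L2_nonneg)
  qed
qed (use F G in auto)

text \<open>The projection is the limit of a sequence in the span that minimizes the distance to g.
  The approximants F are part of the conclusion because membership of f in the closed span is used
  only through them: they are later replaced by combinations of the random variables.\<close>

lemma (in finite_measure) L2_projection:
  assumes k: "\<And>u. u \<in> D \<Longrightarrow> square_integrable M (k u)" and g: "square_integrable M g"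
  obtains F f where "\<And>n. F n \<in> linear_span k D" "square_integrable M f" "tendsto_L2 M F f"
    "\<And>u. u \<in> D \<Longrightarrow> inner_L2 M (\<lambda>x. g x - f x) (k u) = 0"
proof -
  define S where "S = linear_span k D"
  have S: "square_integrable M h" if "h \<in> S" for h
    using square_integrable_linear_span[OF k] that by (simp add: S_def)
  define d where "d = (INF h\<in>S. (norm_L2 M (\<lambda>x. g x - h x))\<^sup>2)"
  have bdd: "bdd_below ((\<lambda>h. (norm_L2 M (\<lambda>x. g x - h x))\<^sup>2) ` S)"
    by (rule bdd_belowI2[of _ 0]) simp
  have d_le: "d \<le> (norm_L2 M (\<lambda>x. g x - h x))\<^sup>2" if "h \<in> S" for h
    unfolding d_def using bdd that by (rule cINF_lower)
  have "S \<noteq> {}" using linear_span_zero by (auto simp: S_def)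
  have "\<exists>h\<in>S. (norm_L2 M (\<lambda>x. g x - h x))\<^sup>2 < d + 1 / Suc n" for n
    using cINF_less_iff[OF \<open>S \<noteq> {}\<close> bdd, of "d + 1 / Suc n"] by (simp add: d_def)
  then obtain F where F: "\<And>n. F n \<in> S"
    and F_less: "\<And>n. (norm_L2 M (\<lambda>x. g x - F n x))\<^sup>2 < d + 1 / Suc n"
    by metis
  have si: "square_integrable M (F n)" for n
    by (rule S[OF F])
  \<comment> \<open>The parallelogram identity, applied to \<open>g - F i\<close> and \<open>g - F j\<close>.\<close>
  have par: "(norm_L2 M (\<lambda>x. F i x - F j x))\<^sup>2 \<le> 2 / Suc i + 2 / Suc j" for i j
  proof -
    define p q where "p x = g x - F i x" and "q x = g x - F j x" for x
    have p: "square_integrable M p" and q: "square_integrable M q"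
      by (simp_all add: p_def[abs_def] q_def[abs_def] square_integrable_diff g si)
    \<comment> \<open>The midpoint of F i and F j lies in the span, so its distance to g is at least
      the infimum, and p + q is twice g - h. Hence the sum term of the identity is at least 4d,
      which cancels the two contributions 2d and leaves only the errors 1 / Suc i and 1 / Suc
      j.\<close>
    define h where "h x = 1/2 * (F i x + F j x)" for x
    have "h \<in> S"
      unfolding h_def S_def
      by (intro linear_span_cmult linear_span_add) (use F in \<open>auto simp: S_def\<close>)
    have "norm_L2 M (\<lambda>x. p x + q x) = norm_L2 M (\<lambda>x. 2 * (g x - h x))"
      by (simp add: p_def q_def h_def algebra_simps)
    then have "4 * d \<le> (norm_L2 M (\<lambda>x. p x + q x))\<^sup>2"
      using d_le[OF \<open>h \<in> S\<close>] by (simp add: norm_L2_cmult power_mult_distrib del: right_diff_distrib_numeral)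
    moreover have "(norm_L2 M (\<lambda>x. p x + q x))\<^sup>2
        = (norm_L2 M p)\<^sup>2 + 2 * inner_L2 M p q + (norm_L2 M q)\<^sup>2"
      by (rule norm_L2_add_power2[OF p q])
    moreover have "(norm_L2 M (\<lambda>x. q x + (-1) * p x))\<^sup>2
        = (norm_L2 M q)\<^sup>2 - 2 * inner_L2 M p q + (norm_L2 M p)\<^sup>2"
      by (subst norm_L2_add_power2[OF q square_integrable_cmult[OF p]])
         (simp only: inner_L2_cmult_right norm_L2_cmult inner_L2_commute[of M q p], simp)
    moreover have "(\<lambda>x. q x + (-1) * p x) = (\<lambda>x. F i x - F j x)"
      by (simp add: p_def q_def)
    moreover have "(norm_L2 M p)\<^sup>2 < d + 1 / Suc i" "(norm_L2 M q)\<^sup>2 < d + 1 / Suc j"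
      using F_less by (simp_all add: p_def[abs_def] q_def[abs_def])
    ultimately show ?thesis by simp
  qed
  have cauchy: "\<exists>N. \<forall>i\<ge>N. \<forall>j\<ge>N. norm_L2 M (\<lambda>x. F i x - F j x) < e" if "0 < e" for e
  proof -
    have "(\<lambda>n. 1 / real (Suc n)) \<longlonglongrightarrow> 0"
      using LIMSEQ_inverse_real_of_nat by (simp add: inverse_eq_divide)
    then obtain N where N: "\<And>n. n \<ge> N \<Longrightarrow> 1 / real (Suc n) < e\<^sup>2 / 4"
      using LIMSEQ_D[of "\<lambda>n. 1 / real (Suc n)" 0 "e\<^sup>2 / 4"] \<open>0 < e\<close> by fastforce
    have "norm_L2 M (\<lambda>x. F i x - F j x) < e" if "i \<ge> N" "j \<ge> N" for i j
    proof (rule power2_less_imp_less)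
      show "(norm_L2 M (\<lambda>x. F i x - F j x))\<^sup>2 < e\<^sup>2"
        using par[of i j] N[OF that(1)] N[OF that(2)] by simp
    qed (use \<open>0 < e\<close> in simp)
    then show ?thesis by blast
  qed
  obtain f where f: "square_integrable M f" and lim: "tendsto_L2 M F f"
    using Riesz_Fischer[of F, OF si cauchy] by blast
  have dist: "(\<lambda>n. (norm_L2 M (\<lambda>x. w x + (-1) * F n x))\<^sup>2)
      \<longlonglongrightarrow> (norm_L2 M (\<lambda>x. w x + (-1) * f x))\<^sup>2" if w: "square_integrable M w" for w
    by (intro tendsto_power norm_L2_tendsto tendsto_L2_add tendsto_L2_cmult tendsto_L2_const
        square_integrable_add square_integrable_cmult w f si lim)
  have "(norm_L2 M (\<lambda>x. g x + (-1) * f x))\<^sup>2 \<le> d"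
  proof (rule LIMSEQ_le[OF dist[OF g]])
    show "(\<lambda>n. d + 1 / Suc n) \<longlonglongrightarrow> d"
      using tendsto_add[OF tendsto_const LIMSEQ_inverse_real_of_nat, of d]
      by (simp add: inverse_eq_divide)
    show "\<exists>N. \<forall>n\<ge>N. (norm_L2 M (\<lambda>x. g x + (-1) * F n x))\<^sup>2 \<le> d + 1 / Suc n"
      using F_less by (simp add: less_imp_le)
  qed
  then have f_le: "(norm_L2 M (\<lambda>x. g x - f x))\<^sup>2 \<le> d"
    by simp
  have "inner_L2 M (\<lambda>x. g x - f x) (k u) = 0" if "u \<in> D" for u
  proof (rule ccontr)
    define p where "p x = g x - f x" for x
    have p: "square_integrable M p"
      unfolding p_def[abs_def] by (intro square_integrable_diff g f)
    define a b where "a = inner_L2 M (k u) (k u)" and "b = inner_L2 M p (k u)"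
    \<comment> \<open>Adding c k u to g - F n amounts to replacing F n by another element of the
      span, so the distance stays at least the infimum; then n tends to infinity.\<close>
    have d_p: "d \<le> (norm_L2 M (\<lambda>x. p x + c * k u x))\<^sup>2" for c
    proof -
      have "(\<lambda>n. (norm_L2 M (\<lambda>x. g x + c * k u x + (-1) * F n x))\<^sup>2)
          \<longlonglongrightarrow> (norm_L2 M (\<lambda>x. g x + c * k u x + (-1) * f x))\<^sup>2"
        by (intro dist square_integrable_add square_integrable_cmult g k that)
      moreover have "d \<le> (norm_L2 M (\<lambda>x. g x + c * k u x + (-1) * F n x))\<^sup>2" for n
      proof -
        have "(\<lambda>x. F n x + (- c) * k u x) \<in> S"
          unfolding S_def
          by (intro linear_span_add linear_span_cmult linear_span_base that)
             (use F in \<open>simp add: S_def\<close>)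
        from d_le[OF this] show ?thesis by (simp add: algebra_simps)
      qed
      ultimately have "d \<le> (norm_L2 M (\<lambda>x. g x + c * k u x + (-1) * f x))\<^sup>2"
        by (intro LIMSEQ_le_const) auto
      then show ?thesis by (simp add: p_def algebra_simps)
    qed
    have expand: "(norm_L2 M (\<lambda>x. p x + c * k u x))\<^sup>2 = (norm_L2 M p)\<^sup>2 + 2 * c * b + c\<^sup>2 * a" for c
      by (subst norm_L2_add_power2[OF p square_integrable_cmult[OF k[OF that]]])
         (simp add: inner_L2_cmult_right norm_L2_cmult power_mult_distrib norm_L2_power2[of M "k u"]
           a_def b_def)
    have "(norm_L2 M p)\<^sup>2 \<le> d"
      using f_le by (simp add: p_def[abs_def])
    then have pos: "0 \<le> 2 * c * b + c\<^sup>2 * a" for c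
      using d_p[of c] expand[of c] by linarith
    assume "inner_L2 M (\<lambda>x. g x - f x) (k u) \<noteq> 0"
    then have "b \<noteq> 0" by (simp add: b_def p_def[abs_def])
    have "0 \<le> a" by (simp add: a_def inner_L2_self_nonneg)
    \<comment> \<open>The exact minimizer would be c = -b/a; the denominator a + 1 still gives a
      negative value and also covers a = 0.\<close>
    have "2 * (- b / (a + 1)) * b + (- b / (a + 1))\<^sup>2 * a = - (b\<^sup>2 * (a + 2) / (a + 1)\<^sup>2)"
      using \<open>0 \<le> a\<close> by (simp add: divide_simps power2_eq_square) algebra
    moreover have "0 < b\<^sup>2 * (a + 2) / (a + 1)\<^sup>2"
      using \<open>b \<noteq> 0\<close> \<open>0 \<le> a\<close> by simp
    ultimately show False
      using pos[of "- b / (a + 1)"] by simp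
  qed
  then show ?thesis
    using that[of F f] F f lim by (simp add: S_def)
qed

subsection \<open>The Wiener integral\<close>

lemma finite_measure_lebesgue_on_interval: "finite_measure (lebesgue_on {a..b::real})"
  by (metis cbox_interval finite_measure_lebesgue_on lmeasurable_cbox)

text \<open>The maximum with 0 covers u > v, where the interval is empty. This occurs for the
  intersection of two disjoint intervals.\<close>

lemma integral_indicator_interval:
  fixes u v T :: real
  assumes "0 \<le> u" "v \<le> T"
  shows "(\<integral>s. indicator {u<..v} s \<partial>lebesgue_on {0..T}) = max 0 (v - u)"
proof -
  have "(\<integral>s. indicator {u<..v} s \<partial>lebesgue_on {0..T}) = measure (lebesgue_on {0..T}) {u<..v}"
  proof -
    have "{u<..v} \<inter> {0..T} = {u<..v}" using assms by auto
    then show ?thesis by simp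
  qed
  also have "\<dots> = measure lebesgue {u<..v}"
    using assms by (subst measure_restrict_space) auto
  also have "\<dots> = max 0 (v - u)"
    by (cases "u \<le> v") auto
  finally show ?thesis .
qed

lemma square_integrable_indicator_interval:
  "square_integrable (lebesgue_on {0..T::real}) (indicator {u<..v})"
proof -
  interpret finite_measure "lebesgue_on {0..T}" by (rule finite_measure_lebesgue_on_interval)
  have meas: "indicat_real {u<..v} \<in> borel_measurable (lebesgue_on {0..T})"
    by (intro measurable_restrict_space1 borel_measurable_indicator) simp
  have "(indicat_real {u<..v} s)\<^sup>2 = indicator {u<..v} s" for s
    by (simp add: indicator_def)
  moreover have "integrable (lebesgue_on {0..T}) (indicat_real {u<..v})"
    by (rule integrable_const_bound[of _ 1, OF AE_I2 meas]) (simp add: indicator_def)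
  ultimately show ?thesis
    using meas by (simp add: square_integrable_def)
qed

section \<open>Linear operations on step functions as operations on lists\<close>

lemma step_fun_Nil: "step_fun [] = (\<lambda>s. 0)"
  by (simp add: step_fun_def[abs_def])

lemma step_fun_Cons:
  "step_fun ((a, u, v) # xs) = (\<lambda>s. a * indicator {u<..v} s + step_fun xs s)"
  by (simp add: step_fun_def[abs_def])

lemma step_wiener_Nil: "step_wiener W [] = (\<lambda>\<omega>. 0)"
  by (simp add: step_wiener_def[abs_def])

lemma step_wiener_Cons:
  "step_wiener W ((a, u, v) # xs) = (\<lambda>\<omega>. a * (W v \<omega> - W u \<omega>) + step_wiener W xs \<omega>)"
  by (simp add: step_wiener_def[abs_def])

lemma step_fun_append: "step_fun (xs @ ys) = (\<lambda>s. step_fun xs s + step_fun ys s)"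
  by (simp add: step_fun_def[abs_def])

lemma step_wiener_append:
  "step_wiener W (xs @ ys) = (\<lambda>\<omega>. step_wiener W xs \<omega> + step_wiener W ys \<omega>)"
  by (simp add: step_wiener_def[abs_def])

definition scale_steps :: "real \<Rightarrow> (real \<times> real \<times> real) list \<Rightarrow> (real \<times> real \<times> real) list" where
  "scale_steps c = map (\<lambda>(a, u, v). (c * a, u, v))"

lemma step_fun_scale: "step_fun (scale_steps c xs) = (\<lambda>s. c * step_fun xs s)"
  by (induction xs)
     (auto simp: scale_steps_def step_fun_Nil step_fun_Cons distrib_left mult.assoc)

lemma step_wiener_scale: "step_wiener W (scale_steps c xs) = (\<lambda>\<omega>. c * step_wiener W xs \<omega>)"
  by (induction xs)
     (auto simp: scale_steps_def step_wiener_Nil step_wiener_Cons distrib_left mult.assoc)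

lemma scale_steps_in: "xs \<in> step_lists T \<Longrightarrow> scale_steps c xs \<in> step_lists T"
  by (auto simp: step_lists_def scale_steps_def)

lemma step_lists_append: "xs \<in> step_lists T \<Longrightarrow> ys \<in> step_lists T \<Longrightarrow> xs @ ys \<in> step_lists T"
  by (auto simp: step_lists_def)

lemma square_integrable_step_fun: "square_integrable (lebesgue_on {0..T}) (step_fun xs)"
  by (induction xs)
     (auto simp: step_fun_Nil step_fun_Cons intro!: square_integrable_zero square_integrable_add
        square_integrable_cmult square_integrable_indicator_interval)

section \<open>Second moments of Brownian increments and the isometry on step functions\<close>

locale brownian_space = prob_space M for M :: "'a measure" +
  fixes T :: real and W :: "real \<Rightarrow> 'a \<Rightarrow> real"
  assumes brownian: "brownian_motion M T W"
begin

abbreviation "L2T \<equiv> lebesgue_on {0..T}"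

lemma increment_less:
  assumes "0 \<le> s" "s < t" "t \<le> T"
  shows "square_integrable M (\<lambda>\<omega>. W t \<omega> - W s \<omega>)"
    "inner_L2 M (\<lambda>\<omega>. W t \<omega> - W s \<omega>) (\<lambda>\<omega>. W t \<omega> - W s \<omega>) = t - s"
proof -
  let ?Y = "\<lambda>\<omega>. W t \<omega> - W s \<omega>"
  have D: "distributed M lborel ?Y (normal_density 0 (sqrt (t - s)))"
    using brownian assms unfolding brownian_motion_def by blast
  have pos: "0 < sqrt (t - s)" using assms by simp
  have "?Y \<in> borel_measurable M"
    using distributed_measurable[OF D] by simp
  moreover have "integrable M (\<lambda>\<omega>. (?Y \<omega>)\<^sup>2)"
    using distributed_integrable[OF D, of "\<lambda>x. x\<^sup>2"] integrable_normal_moment[OF pos, of 0 2] by simp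
  ultimately show "square_integrable M ?Y"
    by (simp add: square_integrable_def)
  show "inner_L2 M ?Y ?Y = t - s"
    using normal_distributed_variance[OF pos D] normal_distributed_expectation[OF pos D] assms
    by (simp add: inner_L2_def power2_eq_square)
qed

text \<open>The definition of Brownian motion gives the law of an increment only for s < t.
  Polarization produces differences in any order, including trivial ones, hence the absolute
  value.\<close>

lemma
  assumes "s \<in> {0..T}" "t \<in> {0..T}"
  shows square_integrable_increment: "square_integrable M (\<lambda>\<omega>. W t \<omega> - W s \<omega>)" (is "?I")
    and inner_increment: "inner_L2 M (\<lambda>\<omega>. W t \<omega> - W s \<omega>) (\<lambda>\<omega>. W t \<omega> - W s \<omega>) = \<bar>t - s\<bar>" (is "?E")
proof -
  consider "s < t" | "t < s" | "s = t" by linarith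
  then have "?I \<and> ?E"
  proof cases
    case 1
    then show ?thesis using increment_less[of s t] assms by simp
  next
    case 2
    have "(\<lambda>\<omega>. W t \<omega> - W s \<omega>) = (\<lambda>\<omega>. (-1) * (W s \<omega> - W t \<omega>))" by simp
    moreover have "square_integrable M (\<lambda>\<omega>. (-1) * (W s \<omega> - W t \<omega>))"
      by (rule square_integrable_cmult[OF increment_less(1)]) (use 2 assms in auto)
    moreover have "inner_L2 M (\<lambda>\<omega>. (-1) * (W s \<omega> - W t \<omega>)) (\<lambda>\<omega>. (-1) * (W s \<omega> - W t \<omega>)) = s - t"
      by (subst inner_L2_cmult_left, subst inner_L2_cmult_right)
         (use increment_less(2)[of t s] 2 assms in simp)
    ultimately show ?thesis using 2 by simp
  next
    case 3
    then show ?thesis by (simp add: square_integrable_zero inner_L2_def)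
  qed
  then show ?I ?E by auto
qed

text \<open>By polarization only the variances of the increments enter, not their independence.\<close>

lemma inner_increments:
  assumes "u \<in> {0..T}" "v \<in> {0..T}" "p \<in> {0..T}" "q \<in> {0..T}"
  shows "inner_L2 M (\<lambda>\<omega>. W v \<omega> - W u \<omega>) (\<lambda>\<omega>. W q \<omega> - W p \<omega>)
    = (\<bar>v - p\<bar> + \<bar>u - q\<bar> - \<bar>v - q\<bar> - \<bar>u - p\<bar>) / 2"
proof -
  have int: "integrable M (\<lambda>\<omega>. (W t \<omega> - W s \<omega>)\<^sup>2)" if "s \<in> {0..T}" "t \<in> {0..T}" for s t
    using square_integrable_increment[OF that] by (simp add: square_integrable_def)
  have E: "(\<integral>\<omega>. (W t \<omega> - W s \<omega>)\<^sup>2 \<partial>M) = \<bar>t - s\<bar>" if "s \<in> {0..T}" "t \<in> {0..T}" for s t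
    using inner_increment[OF that] by (simp add: inner_L2_def power2_eq_square)
  have "inner_L2 M (\<lambda>\<omega>. W v \<omega> - W u \<omega>) (\<lambda>\<omega>. W q \<omega> - W p \<omega>)
    = (\<integral>\<omega>. ((W v \<omega> - W p \<omega>)\<^sup>2 + (W u \<omega> - W q \<omega>)\<^sup>2 - (W v \<omega> - W q \<omega>)\<^sup>2 - (W u \<omega> - W p \<omega>)\<^sup>2) / 2 \<partial>M)"
    unfolding inner_L2_def
    by (intro Bochner_Integration.integral_cong) (auto simp: power2_eq_square field_simps)
  also have "\<dots> = (\<bar>v - p\<bar> + \<bar>u - q\<bar> - \<bar>v - q\<bar> - \<bar>u - p\<bar>) / 2"
    using assms by (simp add: int E)
  finally show ?thesis .
qed

text \<open>Both sides are the length of the overlap of the two intervals: the product of the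
  indicators is the indicator from the larger left end to the smaller right end.\<close>

lemma increments_isometry:
  assumes "0 \<le> u" "u \<le> v" "v \<le> T" "0 \<le> p" "p \<le> q" "q \<le> T"
  shows "inner_L2 M (\<lambda>\<omega>. W v \<omega> - W u \<omega>) (\<lambda>\<omega>. W q \<omega> - W p \<omega>)
    = inner_L2 L2T (indicator {u<..v}) (indicator {p<..q})"
proof -
  have "inner_L2 L2T (indicator {u<..v}) (indicator {p<..q})
      = (\<integral>s. indicator {max u p<..min v q} s \<partial>L2T)"
    unfolding inner_L2_def by (intro Bochner_Integration.integral_cong) (auto simp: indicator_def)
  also have "\<dots> = max 0 (min v q - max u p)"
    by (rule integral_indicator_interval) (use assms in auto)
  also have "\<dots> = (\<bar>v - p\<bar> + \<bar>u - q\<bar> - \<bar>v - q\<bar> - \<bar>u - p\<bar>) / 2"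
    using assms by (auto simp: max_def min_def abs_if)
  finally show ?thesis
    using assms by (simp add: inner_increments)
qed

lemma square_integrable_step_wiener:
  assumes "xs \<in> step_lists T"
  shows "square_integrable M (step_wiener W xs)"
  using assms
proof (induction xs)
  case (Cons x xs)
  then show ?case
    by (cases x)
       (auto simp: step_lists_def step_wiener_Cons intro!: square_integrable_add
         square_integrable_cmult square_integrable_increment)
qed (simp add: step_wiener_Nil square_integrable_zero)

text \<open>Bilinearity reduces the claim to a pair of single intervals. As the isometry is known
  for every pair, overlapping or not, the lists are never brought to a common partition.\<close>

lemma step_wiener_isometry:
  assumes "xs \<in> step_lists T" "ys \<in> step_lists T"
  shows "inner_L2 M (step_wiener W xs) (step_wiener W ys) = inner_L2 L2T (step_fun xs) (step_fun ys)"
  using assms(1)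
proof (induction xs)
  case Nil
  then show ?case by (simp add: step_wiener_Nil step_fun_Nil inner_L2_def)
next
  case (Cons x xs)
  obtain a u v where x: "x = (a, u, v)" by (cases x)
  have xs: "xs \<in> step_lists T" and uv: "0 \<le> u" "u \<le> v" "v \<le> T"
    using Cons.prems by (auto simp: step_lists_def x)
  have single: "inner_L2 M (\<lambda>\<omega>. W v \<omega> - W u \<omega>) (step_wiener W ys)
      = inner_L2 L2T (indicator {u<..v}) (step_fun ys)"
    using assms(2)
  proof (induction ys)
    case Nil
    then show ?case by (simp add: step_wiener_Nil step_fun_Nil inner_L2_def)
  next
    case (Cons y ys)
    obtain b p q where y: "y = (b, p, q)" by (cases y)
    have ys: "ys \<in> step_lists T" and pq: "0 \<le> p" "p \<le> q" "q \<le> T"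
      using Cons.prems by (auto simp: step_lists_def y)
    have "square_integrable M (\<lambda>\<omega>. W v \<omega> - W u \<omega>)" "square_integrable M (\<lambda>\<omega>. W q \<omega> - W p \<omega>)"
      using uv pq by (auto intro: square_integrable_increment)
    then show ?case
      using Cons.IH[OF ys] increments_isometry[OF uv pq] square_integrable_step_wiener[OF ys]
      by (simp add: y step_wiener_Cons step_fun_Cons inner_L2_add_right inner_L2_cmult_right
          square_integrable_cmult square_integrable_step_fun square_integrable_indicator_interval)
  qed
  have "square_integrable M (\<lambda>\<omega>. W v \<omega> - W u \<omega>)"
    using uv by (auto intro: square_integrable_increment)
  then show ?case
    using Cons.IH[OF xs] single square_integrable_step_wiener[OF xs]
      square_integrable_step_wiener[OF assms(2)]
    by (simp add: x step_wiener_Cons step_fun_Cons inner_L2_add_left inner_L2_cmult_left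
        square_integrable_cmult square_integrable_step_fun square_integrable_indicator_interval)
qed

section \<open>The Wiener integral: linearity, isometry, closedness\<close>

lemma wiener_integralD:
  assumes "has_wiener_integral M T W f Y"
  shows "square_integrable L2T f" "square_integrable M Y"
  using assms by (simp_all add: has_wiener_integral_def)

lemma wiener_integral_norm:
  assumes "has_wiener_integral M T W f Y"
  shows "norm_L2 M Y = norm_L2 L2T f"
proof -
  note si = wiener_integralD[OF assms]
  obtain xs where xs: "\<And>n. xs n \<in> step_lists T"
    "tendsto_L2 L2T (\<lambda>n. step_fun (xs n)) f" "tendsto_L2 M (\<lambda>n. step_wiener W (xs n)) Y"
    using assms by (auto simp: has_wiener_integral_def)
  have "(\<lambda>n. norm_L2 L2T (step_fun (xs n))) \<longlonglongrightarrow> norm_L2 L2T f"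
    by (rule norm_L2_tendsto) (use xs si square_integrable_step_fun in auto)
  moreover have "(\<lambda>n. norm_L2 M (step_wiener W (xs n))) \<longlonglongrightarrow> norm_L2 M Y"
    by (rule norm_L2_tendsto) (use xs si square_integrable_step_wiener in auto)
  moreover have "norm_L2 M (step_wiener W (xs n)) = norm_L2 L2T (step_fun (xs n))" for n
    by (simp add: norm_L2_def step_wiener_isometry xs)
  ultimately show ?thesis using LIMSEQ_unique by simp
qed

lemma wiener_integral_add:
  assumes f: "has_wiener_integral M T W f Y" and g: "has_wiener_integral M T W g Z"
  shows "has_wiener_integral M T W (\<lambda>s. f s + g s) (\<lambda>\<omega>. Y \<omega> + Z \<omega>)"
proof -
  note si = wiener_integralD[OF f] wiener_integralD[OF g]
  obtain xs where xs: "\<And>n. xs n \<in> step_lists T"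
    "tendsto_L2 L2T (\<lambda>n. step_fun (xs n)) f" "tendsto_L2 M (\<lambda>n. step_wiener W (xs n)) Y"
    using f by (auto simp: has_wiener_integral_def)
  obtain ys where ys: "\<And>n. ys n \<in> step_lists T"
    "tendsto_L2 L2T (\<lambda>n. step_fun (ys n)) g" "tendsto_L2 M (\<lambda>n. step_wiener W (ys n)) Z"
    using g by (auto simp: has_wiener_integral_def)
  show ?thesis
    unfolding has_wiener_integral_def
  proof (intro conjI exI[of _ "\<lambda>n. xs n @ ys n"] allI)
    show "tendsto_L2 L2T (\<lambda>n. step_fun (xs n @ ys n)) (\<lambda>s. f s + g s)"
      unfolding step_fun_append
      by (intro tendsto_L2_add xs ys si square_integrable_step_fun)
    show "tendsto_L2 M (\<lambda>n. step_wiener W (xs n @ ys n)) (\<lambda>\<omega>. Y \<omega> + Z \<omega>)"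
      unfolding step_wiener_append
      by (intro tendsto_L2_add xs ys si square_integrable_step_wiener)
  qed (use si xs ys in \<open>auto intro: square_integrable_add step_lists_append\<close>)
qed

lemma wiener_integral_cmult:
  assumes f: "has_wiener_integral M T W f Y"
  shows "has_wiener_integral M T W (\<lambda>s. c * f s) (\<lambda>\<omega>. c * Y \<omega>)"
proof -
  note si = wiener_integralD[OF f]
  obtain xs where xs: "\<And>n. xs n \<in> step_lists T"
    "tendsto_L2 L2T (\<lambda>n. step_fun (xs n)) f" "tendsto_L2 M (\<lambda>n. step_wiener W (xs n)) Y"
    using f by (auto simp: has_wiener_integral_def)
  show ?thesis
    unfolding has_wiener_integral_def
  proof (intro conjI exI[of _ "\<lambda>n. scale_steps c (xs n)"] allI)
    show "tendsto_L2 L2T (\<lambda>n. step_fun (scale_steps c (xs n))) (\<lambda>s. c * f s)"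
      unfolding step_fun_scale
      by (intro tendsto_L2_cmult xs si square_integrable_step_fun)
    show "tendsto_L2 M (\<lambda>n. step_wiener W (scale_steps c (xs n))) (\<lambda>\<omega>. c * Y \<omega>)"
      unfolding step_wiener_scale
      by (intro tendsto_L2_cmult xs si square_integrable_step_wiener)
  qed (use si xs in \<open>auto intro: square_integrable_cmult scale_steps_in\<close>)
qed

lemma wiener_integral_diff:
  assumes "has_wiener_integral M T W f Y" "has_wiener_integral M T W g Z"
  shows "has_wiener_integral M T W (\<lambda>s. f s - g s) (\<lambda>\<omega>. Y \<omega> - Z \<omega>)"
  using wiener_integral_add[OF assms(1) wiener_integral_cmult[OF assms(2), of "-1"]] by simp

lemma wiener_integral_zero: "has_wiener_integral M T W (\<lambda>s. 0) (\<lambda>\<omega>. 0)"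
  unfolding has_wiener_integral_def
  by (auto simp: square_integrable_zero step_lists_def step_fun_Nil step_wiener_Nil
      tendsto_L2_const intro!: exI[of _ "\<lambda>_. []"])

lemma wiener_integral_sum:
  "(\<And>i. i \<in> I \<Longrightarrow> has_wiener_integral M T W (f i) (Y i)) \<Longrightarrow>
    has_wiener_integral M T W (\<lambda>s. \<Sum>i\<in>I. f i s) (\<lambda>\<omega>. \<Sum>i\<in>I. Y i \<omega>)"
  by (induction I rule: infinite_finite_induct)
     (auto intro: wiener_integral_add wiener_integral_zero)

text \<open>Polarization: the sum is again a Wiener integral, so the norms of both summands and of
  the sum are preserved, and these three determine the inner product.\<close>

lemma wiener_integral_inner:
  assumes "has_wiener_integral M T W f Y" "has_wiener_integral M T W g Z"
  shows "inner_L2 M Y Z = inner_L2 L2T f g"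
  using wiener_integral_norm[OF assms(1)] wiener_integral_norm[OF assms(2)]
    wiener_integral_norm[OF wiener_integral_add[OF assms]]
    norm_L2_add_power2[OF wiener_integralD(1)[OF assms(1)] wiener_integralD(1)[OF assms(2)]]
    norm_L2_add_power2[OF wiener_integralD(2)[OF assms(1)] wiener_integralD(2)[OF assms(2)]]
  by simp

text \<open>A diagonal argument. For each n one list has to approximate F n and Y n simultaneously;
  this is possible because a single sequence of lists converges to both, so both errors are
  eventually below 1 / Suc n.\<close>

lemma wiener_integral_limit:
  assumes WI: "\<And>n. has_wiener_integral M T W (F n) (Y n)"
    and f: "square_integrable L2T f" "tendsto_L2 L2T F f"
    and Z: "square_integrable M Z" "tendsto_L2 M Y Z"
  shows "has_wiener_integral M T W f Z"
proof -
  note si = wiener_integralD[OF WI]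
  have "\<exists>xs\<in>step_lists T. norm_L2 L2T (\<lambda>s. step_fun xs s - F n s) < 1 / Suc n \<and>
      norm_L2 M (\<lambda>\<omega>. step_wiener W xs \<omega> - Y n \<omega>) < 1 / Suc n" for n
  proof -
    obtain xs where xs: "\<And>m. xs m \<in> step_lists T"
      "tendsto_L2 L2T (\<lambda>m. step_fun (xs m)) (F n)" "tendsto_L2 M (\<lambda>m. step_wiener W (xs m)) (Y n)"
      using WI[of n] by (auto simp: has_wiener_integral_def)
    have "(\<lambda>m. norm_L2 L2T (\<lambda>s. step_fun (xs m) s - F n s)) \<longlonglongrightarrow> 0"
      using xs si tendsto_L2_iff[of L2T "\<lambda>m. step_fun (xs m)" "F n"]
      by (simp add: square_integrable_step_fun)
    then have "\<forall>\<^sub>F m in sequentially. norm_L2 L2T (\<lambda>s. step_fun (xs m) s - F n s) < 1 / Suc n"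
      by (rule order_tendstoD) simp
    moreover have "(\<lambda>m. norm_L2 M (\<lambda>\<omega>. step_wiener W (xs m) \<omega> - Y n \<omega>)) \<longlonglongrightarrow> 0"
      using xs si tendsto_L2_iff[of M "\<lambda>m. step_wiener W (xs m)" "Y n"]
      by (simp add: square_integrable_step_wiener)
    then have "\<forall>\<^sub>F m in sequentially. norm_L2 M (\<lambda>\<omega>. step_wiener W (xs m) \<omega> - Y n \<omega>) < 1 / Suc n"
      by (rule order_tendstoD) simp
    ultimately have "\<forall>\<^sub>F m in sequentially. norm_L2 L2T (\<lambda>s. step_fun (xs m) s - F n s) < 1 / Suc n \<and>
        norm_L2 M (\<lambda>\<omega>. step_wiener W (xs m) \<omega> - Y n \<omega>) < 1 / Suc n"
      by (rule eventually_conj)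
    then show ?thesis
      using xs(1) by (auto simp: eventually_sequentially)
  qed
  then obtain xs where xs: "\<And>n. xs n \<in> step_lists T"
    "\<And>n. norm_L2 L2T (\<lambda>s. step_fun (xs n) s - F n s) < 1 / Suc n"
    "\<And>n. norm_L2 M (\<lambda>\<omega>. step_wiener W (xs n) \<omega> - Y n \<omega>) < 1 / Suc n"
    by metis
  have "tendsto_L2 L2T (\<lambda>n. step_fun (xs n)) f"
    by (rule tendsto_L2_close[where F = F]) (use f si xs square_integrable_step_fun in auto)
  moreover have "tendsto_L2 M (\<lambda>n. step_wiener W (xs n)) Z"
    by (rule tendsto_L2_close[where F = Y]) (use Z si xs square_integrable_step_wiener in auto)
  ultimately show ?thesis
    using f Z xs(1) by (auto simp: has_wiener_integral_def)
qed

text \<open>Used to pass to the particular version chosen by \<open>real_cond_exp\<close>. The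
  constant sequence Y converges to Z in mean square, so closedness under limits applies.\<close>

lemma wiener_integral_cong_AE:
  assumes "has_wiener_integral M T W f Y" "Z \<in> borel_measurable M" "AE \<omega> in M. Z \<omega> = Y \<omega>"
  shows "has_wiener_integral M T W f Z"
proof -
  note Y = wiener_integralD(2)[OF assms(1)]
  have "integrable M (\<lambda>\<omega>. (Z \<omega>)\<^sup>2) = integrable M (\<lambda>\<omega>. (Y \<omega>)\<^sup>2)"
    by (rule integrable_cong_AE) (use assms Y in \<open>auto simp: square_integrable_def\<close>)
  then have Z: "square_integrable M Z"
    using Y assms(2) by (simp add: square_integrable_def)
  have "tendsto_L2 M (\<lambda>n::nat. Y) Z"
  proof -
    have "(\<integral>\<^sup>+\<omega>. ennreal ((Y \<omega> - Z \<omega>)\<^sup>2) \<partial>M) = (\<integral>\<^sup>+\<omega>. 0 \<partial>M)"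
      by (rule nn_integral_cong_AE) (use assms(3) in \<open>auto elim: eventually_mono\<close>)
    then show ?thesis by (simp add: tendsto_L2_def)
  qed
  then show ?thesis
    using wiener_integral_limit[OF assms(1) wiener_integralD(1)[OF assms(1)] tendsto_L2_const Z]
    by simp
qed

end

subsection \<open>Gaussian characteristic functions\<close>

lemma norm_iexp_diff_le: "cmod (iexp x - iexp y) \<le> \<bar>x - y\<bar>"
proof -
  have "iexp x - iexp y = iexp y * (iexp (x - y) - 1)"
    by (simp add: algebra_simps flip: exp_add)
  then have "cmod (iexp x - iexp y) = cmod (iexp (x - y) - 1)"
    by (simp add: norm_mult)
  also have "\<dots> \<le> \<bar>x - y\<bar>"
    using iexp_approx1[of "x - y" 0] by simp
  finally show ?thesis .
qed

context prob_space
begin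

lemma integrable_iexp_real:
  assumes [measurable]: "Y \<in> borel_measurable M"
  shows "integrable M (\<lambda>\<omega>. iexp (Y \<omega>))"
  by (rule integrable_iexp) auto

text \<open>In the degenerate case a centered constant is 0 almost everywhere, and both sides are 1.
  Otherwise Y is \<open>\<sigma>\<close> times a standard normal variable, and the standard
  characteristic function is evaluated at \<open>\<sigma>\<close>.\<close>

lemma gaussian_characteristic:
  assumes gauss: "gaussian_rv M Y" and mean: "expectation Y = 0" and si: "square_integrable M Y"
  shows "(CLINT \<omega>|M. iexp (Y \<omega>)) = exp (- (inner_L2 M Y Y / 2))"
proof -
  have [measurable]: "Y \<in> borel_measurable M"
    using si by (rule square_integrable_measurable)
  consider \<mu> where "AE \<omega> in M. Y \<omega> = \<mu>"
    | \<mu> \<sigma> where "0 < \<sigma>" "distributed M lborel Y (normal_density \<mu> \<sigma>)"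
    using gauss by (auto simp: gaussian_rv_def)
  then show ?thesis
  proof cases
    case 1
    then have "expectation Y = expectation (\<lambda>_. \<mu>)"
      by (intro integral_cong_AE) auto
    then have 0: "AE \<omega> in M. Y \<omega> = 0"
      using 1 mean by (simp add: prob_space)
    have "(CLINT \<omega>|M. iexp (Y \<omega>)) = (CLINT \<omega>|M. 1)"
      by (intro integral_cong_AE) (use 0 in \<open>auto elim: eventually_mono\<close>)
    moreover have "inner_L2 M Y Y = expectation (\<lambda>_. 0)"
      unfolding inner_L2_def
      by (intro integral_cong_AE) (use 0 in \<open>auto elim: eventually_mono\<close>)
    ultimately show ?thesis by (simp add: prob_space)
  next
    case 2
    have "\<mu> = 0"
      using normal_distributed_expectation[OF 2] mean by simp
    have var: "inner_L2 M Y Y = \<sigma>\<^sup>2"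
      using normal_distributed_variance[OF 2] mean by (simp add: inner_L2_def power2_eq_square)
    have "distributed M lborel (\<lambda>\<omega>. Y \<omega> / \<sigma>) std_normal_density"
      using normal_standard_normal_convert[OF 2(1), of Y \<mu>] 2(2) \<open>\<mu> = 0\<close> by simp
    then have distr: "distr M lborel (\<lambda>\<omega>. Y \<omega> / \<sigma>) = std_normal_distribution"
      by (rule distributed_distr_eq_density)
    have "(CLINT \<omega>|M. iexp (Y \<omega>)) = (CLINT \<omega>|M. iexp (\<sigma> * (Y \<omega> / \<sigma>)))"
      using 2(1) by simp
    also have "\<dots> = char std_normal_distribution \<sigma>"
      unfolding char_def distr[symmetric] by (subst integral_distr) auto
    also have "\<dots> = exp (- (inner_L2 M Y Y / 2))"
      by (simp add: char_std_normal_distribution var exp_of_real)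
    finally show ?thesis .
  qed
qed

text \<open>Meant for variables outside the span, such as L + bZ. The left side converges because
  \<open>iexp\<close> is Lipschitz and mean-square convergence implies convergence in mean; the
  right side converges because the norms do.\<close>

lemma gaussian_characteristic_limit:
  assumes V: "\<And>n. square_integrable M (V n)" "square_integrable M Y" "tendsto_L2 M V Y"
    and eq: "\<And>n. (CLINT \<omega>|M. iexp (V n \<omega>)) = exp (- (inner_L2 M (V n) (V n) / 2))"
  shows "(CLINT \<omega>|M. iexp (Y \<omega>)) = exp (- (inner_L2 M Y Y / 2))"
proof (rule LIMSEQ_unique)
  have [measurable]: "V n \<in> borel_measurable M" "Y \<in> borel_measurable M" for n
    using V by (auto intro: square_integrable_measurable)
  have "(\<lambda>n. (CLINT \<omega>|M. iexp (V n \<omega>)) - (CLINT \<omega>|M. iexp (Y \<omega>))) \<longlonglongrightarrow> 0"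
  proof (rule Lim_null_comparison)
    show "(\<lambda>n. norm_L2 M (\<lambda>\<omega>. V n \<omega> - Y \<omega>)) \<longlonglongrightarrow> 0"
      using V tendsto_L2_iff[of M V Y] by simp
    have "cmod ((CLINT \<omega>|M. iexp (V n \<omega>)) - (CLINT \<omega>|M. iexp (Y \<omega>)))
        \<le> norm_L2 M (\<lambda>\<omega>. V n \<omega> - Y \<omega>)" for n
    proof -
      have si: "square_integrable M (\<lambda>\<omega>. V n \<omega> - Y \<omega>)"
        by (intro square_integrable_diff V)
      have "cmod ((CLINT \<omega>|M. iexp (V n \<omega>)) - (CLINT \<omega>|M. iexp (Y \<omega>)))
          = cmod (CLINT \<omega>|M. iexp (V n \<omega>) - iexp (Y \<omega>))"
        by (simp add: integrable_iexp_real)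
      also have "\<dots> \<le> (\<integral>\<omega>. cmod (iexp (V n \<omega>) - iexp (Y \<omega>)) \<partial>M)"
        by (rule integral_norm_bound)
      also have "\<dots> \<le> (\<integral>\<omega>. \<bar>V n \<omega> - Y \<omega>\<bar> \<partial>M)"
        using square_integrable_integrable[OF si]
        by (intro integral_mono norm_iexp_diff_le) (simp_all add: integrable_iexp_real)
      also have "\<dots> \<le> norm_L2 M (\<lambda>\<omega>. V n \<omega> - Y \<omega>)"
        using integral_abs_le_norm_L2[OF si] by (simp add: prob_space)
      finally show ?thesis .
    qed
    then show "\<forall>\<^sub>F n in sequentially. cmod ((CLINT \<omega>|M. iexp (V n \<omega>)) - (CLINT \<omega>|M. iexp (Y \<omega>)))
        \<le> norm_L2 M (\<lambda>\<omega>. V n \<omega> - Y \<omega>)"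
      by simp
  qed
  then show "(\<lambda>n. CLINT \<omega>|M. iexp (V n \<omega>)) \<longlonglongrightarrow> (CLINT \<omega>|M. iexp (Y \<omega>))"
    by (rule LIM_zero_cancel)
  have "(\<lambda>n. (norm_L2 M (V n))\<^sup>2) \<longlonglongrightarrow> (norm_L2 M Y)\<^sup>2"
    by (intro tendsto_power norm_L2_tendsto V)
  then show "(\<lambda>n. CLINT \<omega>|M. iexp (V n \<omega>)) \<longlonglongrightarrow> exp (- (inner_L2 M Y Y / 2))"
    unfolding eq norm_L2_power2 by (intro tendsto_intros) simp_all
qed

text \<open>
  These integrals are the real and imaginary part of the derivative at \<open>b = 0\<close>, divided by \<open>\<i>\<close>, of
  \<open>b \<mapsto> \<E> exp (\<i> (L + b Z))\<close>.
\<close>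

lemma gaussian_uncorrelated:
  assumes L: "square_integrable M L" and Z: "square_integrable M Z"
    and char: "\<And>b. (CLINT \<omega>|M. iexp (L \<omega> + b * Z \<omega>))
      = exp (- (inner_L2 M (\<lambda>\<omega>. L \<omega> + b * Z \<omega>) (\<lambda>\<omega>. L \<omega> + b * Z \<omega>) / 2))"
    and orth: "inner_L2 M L Z = 0"
  shows "(\<integral>\<omega>. Z \<omega> * cos (L \<omega>) \<partial>M) = 0" "(\<integral>\<omega>. Z \<omega> * sin (L \<omega>) \<partial>M) = 0"
proof -
  have [measurable]: "L \<in> borel_measurable M" "Z \<in> borel_measurable M"
    using L Z by (auto intro: square_integrable_measurable)
  have Z_int: "integrable M Z" and Z2_int: "integrable M (\<lambda>\<omega>. (Z \<omega>)\<^sup>2)"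
    using Z by (auto intro: square_integrable_integrable simp: square_integrable_def)
  have int: "integrable M (\<lambda>\<omega>. of_real (Z \<omega>) * iexp (L \<omega>))"
    by (rule Bochner_Integration.integrable_bound[OF Z_int]) (auto simp: norm_mult)
  define a c where "a = inner_L2 M L L" and "c = inner_L2 M Z Z"
  define I where "I = (CLINT \<omega>|M. of_real (Z \<omega>) * iexp (L \<omega>))"
  have "0 \<le> a" "0 \<le> c" by (simp_all add: a_def c_def inner_L2_self_nonneg)
  \<comment> \<open>Orthogonality of L and Z removes the term linear in b from the variance.\<close>
  have char_b: "(CLINT \<omega>|M. iexp (L \<omega> + b * Z \<omega>)) = of_real (exp (- (a / 2)) * exp (- (b\<^sup>2 * c / 2)))" for b
  proof -
    have "inner_L2 M (\<lambda>\<omega>. L \<omega> + b * Z \<omega>) (\<lambda>\<omega>. L \<omega> + b * Z \<omega>) = a + b\<^sup>2 * c"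
      using norm_L2_add_power2[OF L square_integrable_cmult[OF Z, of b]] orth
      unfolding norm_L2_power2 inner_L2_cmult_right inner_L2_cmult_left
      by (simp add: a_def c_def power2_eq_square)
    then show ?thesis
      using char[of b] by (simp add: add_divide_distrib exp_add[symmetric] flip: of_real_mult)
  qed
  \<comment> \<open>The first-order Taylor remainder in b and the change of the characteristic
    function between 0 and b are each bounded by \<open>b\<^sup>2 * c / 2\<close>. Together they
    bound the linear term b I by \<open>b\<^sup>2 * c\<close>.\<close>
  have "cmod I \<le> b * c" if "0 < b" for b
  proof -
    have "cmod (iexp (L \<omega> + b * Z \<omega>) - iexp (L \<omega>) - \<i> * b * (of_real (Z \<omega>) * iexp (L \<omega>)))
        \<le> b\<^sup>2 / 2 * (Z \<omega>)\<^sup>2" for \<omega>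
    proof -
      have "iexp (L \<omega> + b * Z \<omega>) - iexp (L \<omega>) - \<i> * b * (of_real (Z \<omega>) * iexp (L \<omega>))
          = iexp (L \<omega>) * (iexp (b * Z \<omega>) - (\<Sum>k\<le>1. (\<i> * of_real (b * Z \<omega>)) ^ k / fact k))"
        by (simp add: algebra_simps flip: exp_add)
      then show ?thesis
        using iexp_approx1[of "b * Z \<omega>" 1]
        by (simp add: norm_mult power_mult_distrib fact_numeral numeral_2_eq_2[symmetric])
    qed
    note bound = this
    have "cmod (CLINT \<omega>|M. iexp (L \<omega> + b * Z \<omega>) - iexp (L \<omega>) - \<i> * b * (of_real (Z \<omega>) * iexp (L \<omega>)))
        \<le> (\<integral>\<omega>. cmod (iexp (L \<omega> + b * Z \<omega>) - iexp (L \<omega>) - \<i> * b * (of_real (Z \<omega>) * iexp (L \<omega>))) \<partial>M)"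
      by (rule integral_norm_bound)
    also have "\<dots> \<le> (\<integral>\<omega>. b\<^sup>2 / 2 * (Z \<omega>)\<^sup>2 \<partial>M)"
      by (intro integral_mono bound integrable_norm Bochner_Integration.integrable_diff
          integrable_mult_right int integrable_iexp_real Z2_int) measurable
    also have "\<dots> = b\<^sup>2 / 2 * c"
      by (simp add: c_def inner_L2_def power2_eq_square)
    also have "(CLINT \<omega>|M. iexp (L \<omega> + b * Z \<omega>) - iexp (L \<omega>) - \<i> * b * (of_real (Z \<omega>) * iexp (L \<omega>)))
        = (CLINT \<omega>|M. iexp (L \<omega> + b * Z \<omega>)) - (CLINT \<omega>|M. iexp (L \<omega>)) - \<i> * b * I"
    proof -
      have i1: "integrable M (\<lambda>\<omega>. iexp (L \<omega> + b * Z \<omega>))" and i2: "integrable M (\<lambda>\<omega>. iexp (L \<omega>))"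
        by (intro integrable_iexp_real; measurable)+
      show ?thesis
        unfolding I_def
        by (simp only: integral_mult_right_zero Bochner_Integration.integral_diff[OF i1 i2]
            Bochner_Integration.integral_diff[OF Bochner_Integration.integrable_diff[OF i1 i2]
              integrable_mult_right[OF int]])
    qed
    also have "\<dots> = of_real (exp (- (a / 2)) * (exp (- (b\<^sup>2 * c / 2)) - 1)) - \<i> * b * I"
      using char_b[of b] char_b[of 0] by (simp add: algebra_simps)
    finally have "cmod (of_real (exp (- (a / 2)) * (exp (- (b\<^sup>2 * c / 2)) - 1)) - \<i> * b * I) \<le> b\<^sup>2 / 2 * c" .
    moreover have "cmod (\<i> * b * I)
        \<le> cmod (of_real (exp (- (a / 2)) * (exp (- (b\<^sup>2 * c / 2)) - 1)) - \<i> * b * I)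
          + cmod (of_real (exp (- (a / 2)) * (exp (- (b\<^sup>2 * c / 2)) - 1)))"
      using norm_triangle_ineq4[of "of_real (exp (- (a / 2)) * (exp (- (b\<^sup>2 * c / 2)) - 1))"
        "of_real (exp (- (a / 2)) * (exp (- (b\<^sup>2 * c / 2)) - 1)) - \<i> * b * I"] by simp
    moreover have "cmod (of_real (exp (- (a / 2)) * (exp (- (b\<^sup>2 * c / 2)) - 1))) \<le> b\<^sup>2 / 2 * c"
    proof -
      have "exp (- (b\<^sup>2 * c / 2)) \<le> 1" "1 - b\<^sup>2 * c / 2 \<le> exp (- (b\<^sup>2 * c / 2))"
        using \<open>0 \<le> c\<close> exp_ge_add_one_self[of "- (b\<^sup>2 * c / 2)"] by simp_all
      then have "\<bar>exp (- (b\<^sup>2 * c / 2)) - 1\<bar> \<le> b\<^sup>2 * c / 2" by simp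
      moreover have "exp (- (a / 2)) \<le> 1" using \<open>0 \<le> a\<close> by simp
      ultimately have "exp (- (a / 2)) * \<bar>exp (- (b\<^sup>2 * c / 2)) - 1\<bar> \<le> 1 * (b\<^sup>2 * c / 2)"
        by (intro mult_mono) auto
      then show ?thesis by (simp only: norm_of_real abs_mult) simp
    qed
    ultimately have "cmod (\<i> * b * I) \<le> b * (b * c)"
      by (simp add: power2_eq_square)
    then have "b * cmod I \<le> b * (b * c)"
      using that by (simp add: norm_mult)
    then show ?thesis using that by simp
  qed
  note I_le = this
  have "I = 0"
  proof (rule ccontr)
    assume "I \<noteq> 0"
    \<comment> \<open>This b makes b c strictly smaller than the modulus of I; the summand 1 covers
      c = 0.\<close>
    then have "cmod I \<le> cmod I / (c + 1) * c" using I_le[of "cmod I / (c + 1)"] \<open>0 \<le> c\<close> by simp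
    then have "cmod I * (c + 1) \<le> cmod I * c"
      using \<open>0 \<le> c\<close> by (simp add: field_simps)
    then show False using \<open>I \<noteq> 0\<close> by (simp add: distrib_left)
  qed
  have "(\<integral>\<omega>. Z \<omega> * cos (L \<omega>) \<partial>M) = Re I"
    unfolding I_def by (subst integral_Re[symmetric, OF int]) (simp add: Re_exp)
  then show "(\<integral>\<omega>. Z \<omega> * cos (L \<omega>) \<partial>M) = 0" using \<open>I = 0\<close> by simp
  have "(\<integral>\<omega>. Z \<omega> * sin (L \<omega>) \<partial>M) = Im I"
    unfolding I_def by (subst integral_Im[symmetric, OF int]) (simp add: Im_exp)
  then show "(\<integral>\<omega>. Z \<omega> * sin (L \<omega>) \<partial>M) = 0" using \<open>I = 0\<close> by simp
qed

section \<open>From vanishing trigonometric integrals to vanishing integrals over sets\<close>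

lemma integral_distr_density:
  fixes g :: "real \<Rightarrow> 'b::{banach, second_countable_topology}"
  assumes [measurable]: "p \<in> borel_measurable M" "Y \<in> borel_measurable M" "g \<in> borel_measurable borel"
    and "\<And>\<omega>. 0 \<le> p \<omega>"
  shows "integral\<^sup>L (distr (density M (\<lambda>\<omega>. ennreal (p \<omega>))) borel Y) g = (\<integral>\<omega>. p \<omega> *\<^sub>R g (Y \<omega>) \<partial>M)"
  using assms(4) by (subst integral_distr) (simp_all add: integral_density)

lemma integrable_scaleR_bounded:
  fixes h :: "'a \<Rightarrow> 'b::{banach, second_countable_topology}"
  assumes "integrable M R" "h \<in> borel_measurable M" "\<And>\<omega>. norm (h \<omega>) \<le> 1"
  shows "integrable M (\<lambda>\<omega>. R \<omega> *\<^sub>R h \<omega>)"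
proof (rule Bochner_Integration.integrable_bound[OF assms(1)])
  show "AE x in M. norm (R x *\<^sub>R h x) \<le> norm (R x)"
    using assms(3) by (intro AE_I2) (simp add: mult_left_le)
qed (use assms in simp)

text \<open>
  The uniqueness theorem is applied to the image measures under \<open>Y\<close> of the normalized positive and
  negative parts of \<open>V\<close>.
\<close>

lemma Levy_uniqueness_signed:
  fixes V Y :: "'a \<Rightarrow> real"
  assumes V: "integrable M V" and Y [measurable]: "Y \<in> borel_measurable M"
    and cos: "\<And>s. (\<integral>\<omega>. V \<omega> * cos (s * Y \<omega>) \<partial>M) = 0"
    and sin: "\<And>s. (\<integral>\<omega>. V \<omega> * sin (s * Y \<omega>) \<partial>M) = 0"
    and B [measurable]: "B \<in> sets borel"
  shows "(\<integral>\<omega>. V \<omega> * indicator B (Y \<omega>) \<partial>M) = 0"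
proof -
  have [measurable]: "V \<in> borel_measurable M" using V by simp
  define P N where "P \<omega> = max 0 (V \<omega>)" and "N \<omega> = max 0 (- V \<omega>)" for \<omega>
  have [measurable]: "P \<in> borel_measurable M" "N \<in> borel_measurable M"
    by (simp_all add: P_def[abs_def] N_def[abs_def])
  have nonneg: "0 \<le> P \<omega>" "0 \<le> N \<omega>" for \<omega> by (simp_all add: P_def N_def)
  have V_eq: "V \<omega> = P \<omega> - N \<omega>" for \<omega> by (simp add: P_def N_def max_def)
  have P: "integrable M P" and N: "integrable M N"
    using V by (auto simp: P_def[abs_def] N_def[abs_def] intro: integrable_max)
  define m where "m = integral\<^sup>L M P"
  \<comment> \<open>Frequency 0 shows that the positive and negative parts have the same mass, so
    one constant m normalizes both.\<close>
  have "integral\<^sup>L M V = 0" using cos[of 0] by simp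
  then have m: "m = integral\<^sup>L M N"
    using P N by (simp add: m_def V_eq[abs_def])
  show ?thesis
  \<comment> \<open>Normalization is impossible for m = 0, but then V vanishes almost
    everywhere.\<close>
  proof (cases "m = 0")
    case True
    then have "AE \<omega> in M. P \<omega> = 0" "AE \<omega> in M. N \<omega> = 0"
      using P N nonneg m integral_nonneg_eq_0_iff_AE[of M P] integral_nonneg_eq_0_iff_AE[of M N]
      by (simp_all add: m_def)
    then have "AE \<omega> in M. V \<omega> * indicator B (Y \<omega>) = 0"
      by eventually_elim (simp add: V_eq)
    then show ?thesis by (simp add: integral_eq_zero_AE)
  next
    case False
    moreover have "0 \<le> m" by (simp add: m_def nonneg)
    ultimately have "0 < m" by simp
    define MP where "MP = distr (density M (\<lambda>\<omega>. ennreal (P \<omega> / m))) borel Y"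
    define MN where "MN = distr (density M (\<lambda>\<omega>. ennreal (N \<omega> / m))) borel Y"
    have real_dist: "real_distribution (distr (density M (\<lambda>\<omega>. ennreal (R \<omega> / m))) borel Y)"
      if [measurable]: "R \<in> borel_measurable M" and "integrable M R" "integral\<^sup>L M R = m"
        "\<And>\<omega>. 0 \<le> R \<omega>" for R
    proof -
      have "emeasure (density M (\<lambda>\<omega>. ennreal (R \<omega> / m))) (space M) = (\<integral>\<^sup>+\<omega>. ennreal (R \<omega> / m) \<partial>M)"
        by (simp add: emeasure_density cong: nn_integral_cong)
      also have "\<dots> = ennreal (\<integral>\<omega>. R \<omega> / m \<partial>M)"
        by (rule nn_integral_eq_integral) (use that \<open>0 < m\<close> in auto)
      also have "\<dots> = 1"
        using that \<open>0 < m\<close> by simp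
      finally have "prob_space (density M (\<lambda>\<omega>. ennreal (R \<omega> / m)))"
        by (intro prob_spaceI) simp
      then show ?thesis
        by (rule prob_space.real_distribution_distr) simp
    qed
    have quotients: "(\<lambda>\<omega>. P \<omega> / m) \<in> borel_measurable M" "(\<lambda>\<omega>. N \<omega> / m) \<in> borel_measurable M"
      "\<And>\<omega>. 0 \<le> P \<omega> / m" "\<And>\<omega>. 0 \<le> N \<omega> / m"
      using nonneg \<open>0 < m\<close> by simp_all
    note P_eq = integral_distr_density[OF quotients(1) Y _ quotients(3), folded MP_def]
    note N_eq = integral_distr_density[OF quotients(2) Y _ quotients(4), folded MN_def]
    have "char MP = char MN"
    proof
      fix s
      have int: "integrable M (\<lambda>\<omega>. (V \<omega> / m) *\<^sub>R iexp (s * Y \<omega>))"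
        by (rule integrable_scaleR_bounded) (use V in auto)
      have "char MP s - char MN s
          = (CLINT \<omega>|M. (P \<omega> / m) *\<^sub>R iexp (s * Y \<omega>) - (N \<omega> / m) *\<^sub>R iexp (s * Y \<omega>))"
        unfolding char_def
        by (subst P_eq, simp, subst N_eq, simp, rule Bochner_Integration.integral_diff[symmetric])
           (rule integrable_scaleR_bounded; use P N in simp)+
      also have "\<dots> = (CLINT \<omega>|M. (V \<omega> / m) *\<^sub>R iexp (s * Y \<omega>))"
        by (simp add: V_eq diff_divide_distrib scaleR_left_diff_distrib)
      also have "\<dots> = 0"
      proof (rule complex_eqI)
        have "Re (CLINT \<omega>|M. (V \<omega> / m) *\<^sub>R iexp (s * Y \<omega>)) = (\<integral>\<omega>. V \<omega> * cos (s * Y \<omega>) / m \<partial>M)"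
          by (subst integral_Re[symmetric, OF int]) (simp add: Re_exp)
        then show "Re (CLINT \<omega>|M. (V \<omega> / m) *\<^sub>R iexp (s * Y \<omega>)) = Re 0"
          using cos by simp
        have "Im (CLINT \<omega>|M. (V \<omega> / m) *\<^sub>R iexp (s * Y \<omega>)) = (\<integral>\<omega>. V \<omega> * sin (s * Y \<omega>) / m \<partial>M)"
          by (subst integral_Im[symmetric, OF int]) (simp add: Im_exp)
        then show "Im (CLINT \<omega>|M. (V \<omega> / m) *\<^sub>R iexp (s * Y \<omega>)) = Im 0"
          using sin by simp
      qed
      finally show "char MP s = char MN s" by simp
    qed
    moreover have "real_distribution MP" "real_distribution MN"
      unfolding MP_def MN_def by (intro real_dist; use P N nonneg m_def m in simp)+
    ultimately have "MP = MN"
      by (intro Levy_uniqueness)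
    then have "(\<integral>\<omega>. (P \<omega> / m) *\<^sub>R indicat_real B (Y \<omega>) \<partial>M) = (\<integral>\<omega>. (N \<omega> / m) *\<^sub>R indicat_real B (Y \<omega>) \<partial>M)"
      using P_eq[of "indicat_real B"] N_eq[of "indicat_real B"] by simp
    moreover have "integrable M (\<lambda>\<omega>. P \<omega> *\<^sub>R indicat_real B (Y \<omega>))"
      "integrable M (\<lambda>\<omega>. N \<omega> *\<^sub>R indicat_real B (Y \<omega>))"
      by (rule integrable_scaleR_bounded; use P N in \<open>simp add: indicator_def\<close>)+
    ultimately show ?thesis
      using \<open>0 < m\<close> by (simp add: V_eq left_diff_distrib)
  qed
qed

text \<open>Each step of the induction uses up one coordinate. Z times the indicators already
  present is the signed density Q, and L stays arbitrary because testing Q against a frequency s of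
  the new coordinate changes L by a multiple of it.\<close>

lemma integral_finite_dimensional_zero:
  assumes Z: "integrable M Z" and X: "\<And>t. t \<in> D \<Longrightarrow> X t \<in> borel_measurable M"
    and trig: "\<And>L. L \<in> linear_span X D \<Longrightarrow>
      (\<integral>\<omega>. Z \<omega> * cos (L \<omega>) \<partial>M) = 0 \<and> (\<integral>\<omega>. Z \<omega> * sin (L \<omega>) \<partial>M) = 0"
    and J: "finite J" "J \<subseteq> D" and B: "\<And>j. j \<in> J \<Longrightarrow> B j \<in> sets borel"
    and L: "L \<in> linear_span X D"
  shows "(\<integral>\<omega>. Z \<omega> * (\<Prod>j\<in>J. indicator (B j) (X j \<omega>)) * cos (L \<omega>) \<partial>M) = 0 \<and>
    (\<integral>\<omega>. Z \<omega> * (\<Prod>j\<in>J. indicator (B j) (X j \<omega>)) * sin (L \<omega>) \<partial>M) = 0"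
  using J B L
proof (induction J arbitrary: L rule: finite_induct)
  case empty
  then show ?case using trig by simp
next
  case (insert j J)
  define Q where "Q \<omega> = Z \<omega> * (\<Prod>j\<in>J. indicator (B j) (X j \<omega>))" for \<omega>
  have IH: "(\<integral>\<omega>. Q \<omega> * cos (L' \<omega>) \<partial>M) = 0" "(\<integral>\<omega>. Q \<omega> * sin (L' \<omega>) \<partial>M) = 0"
    if "L' \<in> linear_span X D" for L'
    using insert.IH[OF _ _ that] insert.prems by (auto simp: Q_def)
  note [measurable] = borel_measurable_linear_span[OF X insert.prems(3)]
  have "j \<in> D" using insert.prems by simp
  note [measurable] = X[OF this]
  have [measurable]: "Z \<in> borel_measurable M" using Z by simp
  have [measurable]: "Q \<in> borel_measurable M"
    unfolding Q_def[abs_def]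
    by (intro borel_measurable_times borel_measurable_prod measurable_compose[OF X]
        borel_measurable_indicator) (use insert.prems in auto)
  have "\<bar>\<Prod>j\<in>J. indicat_real (B j) (X j \<omega>)\<bar> \<le> 1" for \<omega>
    unfolding abs_prod by (intro prod_le_1) (auto simp: indicator_def)
  then have Q: "integrable M Q"
    by (intro Bochner_Integration.integrable_bound[OF Z])
       (simp_all add: Q_def abs_mult mult_left_le)
  have bounded: "integrable M (\<lambda>\<omega>. Q \<omega> * h \<omega>)"
    if "h \<in> borel_measurable M" "\<And>\<omega>. \<bar>h \<omega>\<bar> \<le> 1" for h :: "'a \<Rightarrow> real"
    by (rule Bochner_Integration.integrable_bound[OF Q])
       (use that in \<open>simp_all add: abs_mult mult_left_le\<close>)
  have shift: "(\<lambda>\<omega>. L \<omega> + s * X j \<omega>) \<in> linear_span X D" for s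
    by (intro linear_span_add linear_span_cmult linear_span_base \<open>j \<in> D\<close> insert.prems)
  have C: "(\<integral>\<omega>. Q \<omega> * cos (L \<omega> + s * X j \<omega>) \<partial>M) = 0" "(\<integral>\<omega>. Q \<omega> * sin (L \<omega> + s * X j \<omega>) \<partial>M) = 0"
    "(\<integral>\<omega>. Q \<omega> * cos (L \<omega> - s * X j \<omega>) \<partial>M) = 0" "(\<integral>\<omega>. Q \<omega> * sin (L \<omega> - s * X j \<omega>) \<partial>M) = 0" for s
    using IH[OF shift[of s]] IH[OF shift[of "- s"]] by simp_all
  have int: "integrable M (\<lambda>\<omega>. Q \<omega> * cos (L \<omega> + s * X j \<omega>))" "integrable M (\<lambda>\<omega>. Q \<omega> * sin (L \<omega> + s * X j \<omega>))"
    "integrable M (\<lambda>\<omega>. Q \<omega> * cos (L \<omega> - s * X j \<omega>))" "integrable M (\<lambda>\<omega>. Q \<omega> * sin (L \<omega> - s * X j \<omega>))" for s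
    by (rule bounded; simp)+
  \<comment> \<open>Product-to-sum formulas: a trigonometric factor in s X j moves L to L + s X j
    and L - s X j, both in the span, so the integrals required by the uniqueness lemma are
    combinations of those in \<open>C\<close>.\<close>
  have cc: "Q \<omega> * cos (L \<omega>) * cos (s * X j \<omega>)
      = (Q \<omega> * cos (L \<omega> - s * X j \<omega>) + Q \<omega> * cos (L \<omega> + s * X j \<omega>)) / 2"
    and cs: "Q \<omega> * cos (L \<omega>) * sin (s * X j \<omega>)
      = (Q \<omega> * sin (L \<omega> + s * X j \<omega>) - Q \<omega> * sin (L \<omega> - s * X j \<omega>)) / 2"
    and sc: "Q \<omega> * sin (L \<omega>) * cos (s * X j \<omega>)
      = (Q \<omega> * sin (L \<omega> + s * X j \<omega>) + Q \<omega> * sin (L \<omega> - s * X j \<omega>)) / 2"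
    and ss: "Q \<omega> * sin (L \<omega>) * sin (s * X j \<omega>)
      = (Q \<omega> * cos (L \<omega> - s * X j \<omega>) - Q \<omega> * cos (L \<omega> + s * X j \<omega>)) / 2" for \<omega> s
    by (simp_all add: cos_add cos_diff sin_add sin_diff algebra_simps)
  have "(\<integral>\<omega>. Q \<omega> * cos (L \<omega>) * indicator (B j) (X j \<omega>) \<partial>M) = 0"
    by (rule Levy_uniqueness_signed)
       (use insert.prems in \<open>simp_all add: bounded cc cs C int\<close>)
  moreover have "(\<integral>\<omega>. Q \<omega> * sin (L \<omega>) * indicator (B j) (X j \<omega>) \<partial>M) = 0"
    by (rule Levy_uniqueness_signed)
       (use insert.prems in \<open>simp_all add: bounded sc ss C int\<close>)
  ultimately show ?case
    using insert.hyps by (simp add: Q_def mult_ac)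
qed

text \<open>Dynkin's argument: the sets over which Z integrates to 0 are closed under complements
  and countable disjoint unions, and they contain the cylinder sets, which are stable under
  intersection.\<close>

lemma integral_sigma_generated_zero:
  assumes Z: "integrable M Z" and X: "\<And>t. t \<in> D \<Longrightarrow> X t \<in> borel_measurable M"
    and trig: "\<And>L. L \<in> linear_span X D \<Longrightarrow>
      (\<integral>\<omega>. Z \<omega> * cos (L \<omega>) \<partial>M) = 0 \<and> (\<integral>\<omega>. Z \<omega> * sin (L \<omega>) \<partial>M) = 0"
    and A: "A \<in> sets (sigma_generated M X D)"
  shows "(LINT \<omega>:A|M. Z \<omega>) = 0"
proof -
  define cyl where "cyl J B = {\<omega> \<in> space M. \<forall>j\<in>J. X j \<omega> \<in> B j}" for J B
  define G where "G = {cyl J B | J B. finite J \<and> J \<subseteq> D \<and> (\<forall>j\<in>J. B j \<in> sets borel)}"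
  have cyl_sets: "cyl J B \<in> sets M" if "finite J" "J \<subseteq> D" "\<forall>j\<in>J. B j \<in> sets borel" for J B
    unfolding cyl_def
  proof (rule sets.sets_Collect_finite_All)
    fix j assume "j \<in> J"
    then have "X j -` B j \<inter> space M \<in> sets M"
      using that X by (intro measurable_sets[of _ M borel]) auto
    then show "{\<omega> \<in> space M. X j \<omega> \<in> B j} \<in> sets M"
      by (simp add: vimage_def Int_def conj_commute)
  qed (use that in auto)
  then have "G \<subseteq> sets M" by (auto simp: G_def)
  then have G_Pow: "G \<subseteq> Pow (space M)" using sets.sets_into_space by blast
  have sigma_M: "sigma_sets (space M) G \<subseteq> sets M"
    using \<open>G \<subseteq> sets M\<close> by (rule sets.sigma_sets_subset)
  have stable: "Int_stable G"
  proof (rule Int_stableI)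
    fix a b assume "a \<in> G" "b \<in> G"
    then obtain J B J' B' where a: "a = cyl J B" "finite J" "J \<subseteq> D" "\<forall>j\<in>J. B j \<in> sets borel"
      and b: "b = cyl J' B'" "finite J'" "J' \<subseteq> D" "\<forall>j\<in>J'. B' j \<in> sets borel"
      by (auto simp: G_def)
    \<comment> \<open>A coordinate that one of the cylinders does not constrain receives the whole
      line, so the intersection is again a cylinder over the union of the index sets.\<close>
    define B'' where "B'' j = (if j \<in> J then B j else UNIV) \<inter> (if j \<in> J' then B' j else UNIV)" for j
    have "a \<inter> b = cyl (J \<union> J') B''"
      unfolding a(1) b(1) cyl_def B''_def by auto
    then show "a \<inter> b \<in> G"
      unfolding G_def using a b by (auto intro!: exI[of _ "J \<union> J'"] exI[of _ B''] simp: B''_def)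
  qed
  have "A \<in> sigma_sets (space M) G"
  proof -
    let ?E = "\<Union>t\<in>D. {X t -` B \<inter> space M | B. B \<in> sets borel}"
    have "?E \<subseteq> G"
    proof clarify
      fix t B assume "t \<in> D" "B \<in> sets (borel :: real measure)"
      then show "X t -` B \<inter> space M \<in> G"
        unfolding G_def cyl_def by (auto intro!: exI[of _ "{t}"] exI[of _ "\<lambda>_. B"])
    qed
    moreover have "sets (sigma_generated M X D) = sigma_sets (space M) ?E"
      unfolding sigma_generated_def by (rule sets_measure_of) auto
    ultimately show ?thesis
      using A sigma_sets_mono'[of ?E G "space M"] by auto
  qed
  with stable G_Pow show ?thesis
  proof (induction rule: sigma_sets_induct_disjoint)
    case (basic A)
    then obtain J B where A: "A = cyl J B" and J: "finite J" "J \<subseteq> D" "\<forall>j\<in>J. B j \<in> sets borel"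
      by (auto simp: G_def)
    have "(LINT \<omega>:A|M. Z \<omega>) = (\<integral>\<omega>. Z \<omega> * (\<Prod>j\<in>J. indicator (B j) (X j \<omega>)) * cos 0 \<partial>M)"
      unfolding set_lebesgue_integral_def
    proof (rule Bochner_Integration.integral_cong)
      fix \<omega> assume "\<omega> \<in> space M"
      then have "indicat_real A \<omega> = (\<Prod>j\<in>J. indicator (B j) (X j \<omega>))"
        using J(1) by (auto simp: A cyl_def indicator_def prod.neutral intro: prod_zero)
      then show "indicat_real A \<omega> *\<^sub>R Z \<omega> = Z \<omega> * (\<Prod>j\<in>J. indicator (B j) (X j \<omega>)) * cos 0"
        by simp
    qed simp
    also have "\<dots> = 0"
      using integral_finite_dimensional_zero[OF Z X trig J(1,2) _ linear_span_zero] J(3) by auto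
    finally show ?case .
  next
    case empty
    then show ?case by (simp add: set_lebesgue_integral_def)
  next
    case (compl A)
    then have "A \<in> sets M" using sigma_M by auto
    have "(LINT \<omega>:space M - A|M. Z \<omega>) = (\<integral>\<omega>. Z \<omega> - indicator A \<omega> *\<^sub>R Z \<omega> \<partial>M)"
      unfolding set_lebesgue_integral_def
      by (intro Bochner_Integration.integral_cong) (auto simp: indicator_def)
    also have "\<dots> = (\<integral>\<omega>. Z \<omega> \<partial>M) - (LINT \<omega>:A|M. Z \<omega>)"
      unfolding set_lebesgue_integral_def
      by (intro Bochner_Integration.integral_diff Z integrable_mult_indicator \<open>A \<in> sets M\<close>)
    also have "\<dots> = 0"
      \<comment> \<open>For L = 0 the cosine is 1, so the trigonometric hypothesis says that Z has
        expectation 0.\<close>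
      using trig[OF linear_span_zero] compl by simp
    finally show ?case .
  next
    case (union A)
    then have A: "A i \<in> sets M" for i using sigma_M by auto
    have "(LINT \<omega>:(\<Union>i. A i)|M. Z \<omega>) = (\<Sum>i. LINT \<omega>:A i|M. Z \<omega>)"
    proof (rule lebesgue_integral_countable_add)
      show "set_integrable M (\<Union>i. A i) Z"
        unfolding set_integrable_def by (rule integrable_mult_indicator) (use A Z in auto)
    qed (use A union in \<open>auto simp: disjoint_family_on_def\<close>)
    then show ?case using union by simp
  qed
qed

end

subsection \<open>The conditional expectation\<close>

lemma sigma_generated_basic:
  assumes "t \<in> D" "B \<in> sets borel"
  shows "X t -` B \<inter> space M \<in> sets (sigma_generated M X D)"
proof -
  have "sets (sigma_generated M X D)
      = sigma_sets (space M) (\<Union>t\<in>D. {X t -` B \<inter> space M | B. B \<in> sets borel})"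
    unfolding sigma_generated_def by (rule sets_measure_of) auto
  then show ?thesis using assms by auto
qed

lemma space_sigma_generated: "space (sigma_generated M X D) = space M"
  unfolding sigma_generated_def by (rule space_measure_of) auto

lemma measurable_sigma_generated:
  "t \<in> D \<Longrightarrow> X t \<in> borel_measurable (sigma_generated M X D)"
  by (intro measurableI) (auto simp: space_sigma_generated sigma_generated_basic)

lemma subalgebra_sigma_generated:
  assumes "\<And>t. t \<in> D \<Longrightarrow> X t \<in> borel_measurable M"
  shows "subalgebra M (sigma_generated M X D)"
proof -
  have "sets (sigma_generated M X D)
      = sigma_sets (space M) (\<Union>t\<in>D. {X t -` B \<inter> space M | B. B \<in> sets borel})"
    unfolding sigma_generated_def by (rule sets_measure_of) auto
  also have "\<dots> \<subseteq> sets M"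
    by (rule sets.sigma_sets_subset) (use assms in \<open>auto intro: measurable_sets\<close>)
  finally show ?thesis
    by (simp add: subalgebra_def space_sigma_generated)
qed

text \<open>The same coefficients work on both sides. This is how approximants of f in the kernel
  span become random variables that depend only on the observed X u.\<close>

lemma (in brownian_space) wiener_integral_linear_span:
  assumes "\<And>u. u \<in> D \<Longrightarrow> has_wiener_integral M T W (K u) (X u)" "F \<in> linear_span K D"
  shows "\<exists>Y\<in>linear_span X D. has_wiener_integral M T W F Y"
proof -
  obtain J c where J: "finite J" "J \<subseteq> D" and F: "F = (\<lambda>s. \<Sum>u\<in>J. c u * K u s)"
    using assms(2) by (auto simp: linear_span_def)
  have "has_wiener_integral M T W F (\<lambda>\<omega>. \<Sum>u\<in>J. c u * X u \<omega>)"
    unfolding F by (intro wiener_integral_sum wiener_integral_cmult assms(1)) (use J in auto)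
  moreover have "(\<lambda>\<omega>. \<Sum>u\<in>J. c u * X u \<omega>) \<in> linear_span X D"
    unfolding linear_span_def using J by blast
  ultimately show ?thesis by blast
qed

text \<open>The function f enters through its approximants and its orthogonality relations: the
  former make the Wiener integral measurable for the observations, the latter make the residual
  uncorrelated with them.\<close>

theorem (in brownian_space) conditional_expectation_wiener:
  assumes gauss: "centered_gaussian_process M {0..T} X"
    and WI: "\<And>u. u \<in> {0..T} \<Longrightarrow> has_wiener_integral M T W (K u) (X u)"
    and D: "D \<subseteq> {0..T}" and t: "t \<in> {0..T}"
    and F: "\<And>n. F n \<in> linear_span K D" and f: "square_integrable L2T f" "tendsto_L2 L2T F f"
    and orth: "\<And>u. u \<in> D \<Longrightarrow> inner_L2 L2T (\<lambda>s. K t s - f s) (K u) = 0"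
  shows "has_wiener_integral M T W f (real_cond_exp M (sigma_generated M X D) (X t))"
proof -
  let ?F = "sigma_generated M X D"
  have siX: "square_integrable M (X u)" if "u \<in> {0..T}" for u
    using wiener_integralD(2)[OF WI[OF that]] .
  have mX: "X u \<in> borel_measurable M" if "u \<in> {0..T}" for u
    using siX[OF that] by (rule square_integrable_measurable)
  have sub: "subalgebra M ?F"
    using subalgebra_sigma_generated[of D X M] mX D by blast
  interpret FM: finite_measure_subalgebra M ?F
    by standard (rule sub)
  \<comment> \<open>Completeness is applied over the restricted measure, so that the limit is
    measurable with respect to \<open>\<F>\<^sub>\<Delta>\<close> itself and not only equal almost
    everywhere to such a function.\<close>
  interpret MF: finite_measure "restr_to_subalg M ?F"
    by (rule finite_measure_restr_to_subalg[OF sub]) (rule finite_measure_axioms)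
  have si_F: "square_integrable (restr_to_subalg M ?F) g"
    if "square_integrable M g" "g \<in> borel_measurable ?F" for g
    using that measurable_in_subalg[OF sub that(2)]
    by (auto simp: square_integrable_def intro!: integrable_in_subalg[OF sub])
  have norm_F: "norm_L2 (restr_to_subalg M ?F) g = norm_L2 M g" if "g \<in> borel_measurable ?F" for g
    using that by (simp add: norm_L2_def inner_L2_def integral_subalgebra2[OF sub])
  have "\<exists>Y. Y \<in> linear_span X D \<and> has_wiener_integral M T W (F n) Y" for n
    using wiener_integral_linear_span[OF _ F[of n]] WI D by blast
  then obtain Y where Y: "\<And>n. Y n \<in> linear_span X D"
    and Y_WI: "\<And>n. has_wiener_integral M T W (F n) (Y n)"
    by metis
  have siY: "square_integrable M (Y n)" for n
    using wiener_integralD(2)[OF Y_WI] .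
  have [measurable]: "Y n \<in> borel_measurable ?F" for n
    by (rule borel_measurable_linear_span[OF measurable_sigma_generated Y])
  obtain V where V': "square_integrable (restr_to_subalg M ?F) V"
    "tendsto_L2 (restr_to_subalg M ?F) Y V"
  proof (rule MF.Riesz_Fischer)
    \<comment> \<open>The isometry makes the Y n Cauchy because the F n converge; restricting the
      measure does not change the norm of functions measurable for the smaller algebra.\<close>
    show "\<exists>N. \<forall>i\<ge>N. \<forall>j\<ge>N. norm_L2 (restr_to_subalg M ?F) (\<lambda>\<omega>. Y i \<omega> - Y j \<omega>) < e" if "0 < e" for e
      using tendsto_L2_imp_Cauchy[OF wiener_integralD(1)[OF Y_WI] f that]
      by (simp add: norm_F wiener_integral_norm[OF wiener_integral_diff[OF Y_WI Y_WI]])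
  qed (use si_F siY in auto)
  have V_F [measurable]: "V \<in> borel_measurable ?F"
    using measurable_in_subalg'[OF sub square_integrable_measurable[OF V'(1)]] .
  have siV: "square_integrable M V"
    using V'(1) measurable_from_subalg[OF sub V_F] integrable_from_subalg[OF sub]
    by (auto simp: square_integrable_def)
  have limV: "tendsto_L2 M Y V"
    using V'(2) by (simp add: tendsto_L2_def nn_integral_subalgebra2[OF sub])
  have V_WI: "has_wiener_integral M T W f V"
    by (rule wiener_integral_limit[OF Y_WI f siV limV])

  define Z where "Z \<omega> = X t \<omega> - V \<omega>" for \<omega>
  have Z_WI: "has_wiener_integral M T W (\<lambda>s. K t s - f s) Z"
    unfolding Z_def[abs_def] by (rule wiener_integral_diff[OF WI[OF t] V_WI])
  note siZ = wiener_integralD(2)[OF Z_WI]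
  have span_char: "(CLINT \<omega>|M. iexp (L \<omega>)) = exp (- (inner_L2 M L L / 2))"
    if "L \<in> linear_span X {0..T}" for L
  proof (rule gaussian_characteristic)
    show "gaussian_rv M L"
      using gauss that by (simp add: centered_gaussian_process_def)
    show "square_integrable M L"
      by (rule square_integrable_linear_span[OF siX that])
    from that obtain J c where "finite J" "J \<subseteq> {0..T}" and L: "L = (\<lambda>\<omega>. \<Sum>s\<in>J. c s * X s \<omega>)"
      by (auto simp: linear_span_def)
    moreover have "integrable M (X s)" "expectation (X s) = 0" if "s \<in> {0..T}" for s
      using gauss that square_integrable_integrable[OF siX]
      by (auto simp: centered_gaussian_process_def)
    ultimately show "expectation L = 0"
      by (simp add: L subset_iff)
  qed
  have trig: "(\<integral>\<omega>. Z \<omega> * cos (L \<omega>) \<partial>M) = 0 \<and> (\<integral>\<omega>. Z \<omega> * sin (L \<omega>) \<partial>M) = 0"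
    if L: "L \<in> linear_span X D" for L
  proof -
    have L_T: "L \<in> linear_span X {0..T}"
      using L linear_span_mono[OF D] by blast
    have siL: "square_integrable M L"
      by (rule square_integrable_linear_span[OF siX L_T])
    have "inner_L2 M L Z = 0"
    proof -
      obtain J c where J: "finite J" "J \<subseteq> D" and L_eq: "L = (\<lambda>\<omega>. \<Sum>s\<in>J. c s * X s \<omega>)"
        using L by (auto simp: linear_span_def)
      have "inner_L2 M L Z = (\<Sum>s\<in>J. inner_L2 M (\<lambda>\<omega>. c s * X s \<omega>) Z)"
        unfolding L_eq
        by (rule inner_L2_sum_left[OF square_integrable_cmult[OF siX] siZ]) (use J D in auto)
      also have "\<dots> = 0"
      proof (rule sum.neutral, rule ballI)
        fix s assume "s \<in> J"
        then have s: "s \<in> D" "s \<in> {0..T}" using J D by auto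
        have "inner_L2 M (X s) Z = inner_L2 L2T (K s) (\<lambda>s. K t s - f s)"
          by (rule wiener_integral_inner[OF WI[OF s(2)] Z_WI])
        also have "\<dots> = 0"
          using orth[OF s(1)] by (subst inner_L2_commute)
        finally show "inner_L2 M (\<lambda>\<omega>. c s * X s \<omega>) Z = 0"
          by (simp add: inner_L2_cmult_left)
      qed
      finally show ?thesis .
    qed
    moreover have "(CLINT \<omega>|M. iexp (L \<omega> + b * Z \<omega>))
        = exp (- (inner_L2 M (\<lambda>\<omega>. L \<omega> + b * Z \<omega>) (\<lambda>\<omega>. L \<omega> + b * Z \<omega>) / 2))" for b
    proof (rule gaussian_characteristic_limit)
      \<comment> \<open>Z itself need not belong to the span of X. Replacing V by Y n gives elements
        of the span, to which the Gaussian hypothesis applies, and these converge to L + bZ.\<close>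
      let ?U = "\<lambda>n \<omega>. L \<omega> + b * (X t \<omega> + (-1) * Y n \<omega>)"
      have U: "?U n \<in> linear_span X {0..T}" for n
        using Y[of n] linear_span_mono[OF D, of X]
        by (intro linear_span_add linear_span_cmult linear_span_base L_T t) blast
      show "square_integrable M (?U n)" for n
        by (rule square_integrable_linear_span[OF siX U])
      show "square_integrable M (\<lambda>\<omega>. L \<omega> + b * Z \<omega>)"
        by (intro square_integrable_add square_integrable_cmult siL siZ)
      have "tendsto_L2 M ?U (\<lambda>\<omega>. L \<omega> + b * (X t \<omega> + (-1) * V \<omega>))"
        by (intro tendsto_L2_add tendsto_L2_cmult tendsto_L2_const limV square_integrable_add
            square_integrable_cmult siL siX siY siV t)
      then show "tendsto_L2 M ?U (\<lambda>\<omega>. L \<omega> + b * Z \<omega>)"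
        by (simp add: Z_def)
      show "(CLINT \<omega>|M. iexp (?U n \<omega>)) = exp (- (inner_L2 M (?U n) (?U n) / 2))" for n
        by (rule span_char[OF U])
    qed
    ultimately show ?thesis
      using gaussian_uncorrelated[OF siL siZ] by blast
  qed
  \<comment> \<open>The conditional expectation is characterized by its integrals over sets of
    \<open>\<F>\<^sub>\<Delta>\<close>, so the vanishing integrals of Z identify it with V up to a
    null set.\<close>
  have "AE \<omega> in M. real_cond_exp M ?F (X t) \<omega> = V \<omega>"
  proof (rule FM.real_cond_exp_charact)
    show X_int: "integrable M (X t)" and V_int: "integrable M V"
      by (intro square_integrable_integrable siX siV t)+
    fix A assume A: "A \<in> sets ?F"
    then have "A \<in> sets M" using sub by (auto simp: subalgebra_def)
    have "(LINT \<omega>:A|M. X t \<omega>) - (LINT \<omega>:A|M. V \<omega>) = (LINT \<omega>:A|M. Z \<omega>)"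
      unfolding Z_def
      by (rule set_integral_diff(2)[symmetric])
         (simp_all only: set_integrable_def integrable_mult_indicator[OF \<open>A \<in> sets M\<close>] X_int V_int)
    also have "\<dots> = 0"
      by (rule integral_sigma_generated_zero[OF square_integrable_integrable[OF siZ] _ trig A])
         (use mX D in auto)
    finally show "(LINT \<omega>:A|M. X t \<omega>) = (LINT \<omega>:A|M. V \<omega>)" by simp
  qed (rule V_F)
  then show ?thesis
    by (intro wiener_integral_cong_AE[OF V_WI]) auto
qed

text \<open>Since elements of \<open>L\<^sup>2\<close> are functions here, "the solution" is
  rendered as existence together with uniqueness almost everywhere. The Wiener integral is a
  relation for the same reason: the chosen version of the conditional expectation is asserted to be
  one of its versions.\<close>

theorem theorem2p1:
  fixes M :: "'a measure" and T :: real
    and X W :: "real \<Rightarrow> 'a \<Rightarrow> real" and K :: "real \<Rightarrow> real \<Rightarrow> real"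
    and n :: nat and tL tU :: "nat \<Rightarrow> real" and \<Delta> :: "real set"
  assumes "prob_space M"
    and "0 < T"
    and "centered_gaussian_process M {0..T} X"
    and "separable_process M {0..T} X"
    and "(SUP t\<in>{0..T}. \<integral>\<^sup>+\<omega>. ennreal ((X t \<omega>)\<^sup>2) \<partial>M) < \<infinity>"
    and "square_integrable (lebesgue_on ({0..T} \<times> {0..T})) (\<lambda>(t, s). K t s)"
    and "brownian_motion M T W"
    and "\<forall>t\<in>{0..T}. has_wiener_integral M T W (K t) (X t)"
    and "first_chaos M X T = first_chaos M W T"
    and "1 \<le> n"
    and "0 \<le> tL 1"
    and "\<forall>k\<in>{1..n}. tL k < tU k"
    and "\<forall>k\<in>{1..<n}. tU k < tL (Suc k)"
    and "tU n \<le> T"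
    and "\<Delta> = (\<Union>k\<in>{1..n}. {tL k..tU k})"
  shows "\<forall>t\<in>{0..T} - \<Delta>. \<exists>f.
    fredholm_solution T K \<Delta> t f \<and> orthogonal_to_kernel_complement T K \<Delta> f \<and>
    (\<forall>h. fredholm_solution T K \<Delta> t h \<and> orthogonal_to_kernel_complement T K \<Delta> h \<longrightarrow>
       (AE s in lebesgue_on {0..T}. h s = f s)) \<and>
    has_wiener_integral M T W f (real_cond_exp M (sigma_generated M X \<Delta>) (X t))"
proof
  fix t assume "t \<in> {0..T} - \<Delta>"
  then have t: "t \<in> {0..T}" by simp
  interpret brownian_space M T W
    by (intro brownian_space.intro brownian_space_axioms.intro assms(1,7))
  interpret L2T: finite_measure L2T
    by (rule finite_measure_lebesgue_on_interval)
  \<comment> \<open>Only the first left end is bounded by hypothesis, so the bound is carried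
    upwards along the chain of endpoints.\<close>
  have lower: "0 \<le> tL k" if "k \<in> {1..n}" for k
  proof -
    have "k \<le> n \<longrightarrow> 0 \<le> tL k" if "1 \<le> k" for k
      using that
    proof (induction k rule: dec_induct)
      case base
      show ?case using assms(11) by simp
    next
      case (step k)
      show ?case
      proof
        assume "Suc k \<le> n"
        then have "0 \<le> tL k" "tL k < tU k" "tU k < tL (Suc k)"
          using step assms(12,13) by auto
        then show "0 \<le> tL (Suc k)" by simp
      qed
    qed
    then show ?thesis using that by simp
  qed
  \<comment> \<open>Symmetrically, the bound on the last right end is carried downwards.\<close>
  have upper: "tU k \<le> T" if "k \<in> {1..n}" for k
  proof -
    have "k \<le> n" "1 \<le> k" using that by auto
    then show ?thesis
    proof (induction k rule: inc_induct)
      case base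
      show ?case using assms(14) .
    next
      case (step k)
      then have "tU k < tL (Suc k)" "tL (Suc k) < tU (Suc k)" "tU (Suc k) \<le> T"
        using assms(12,13) by auto
      then show ?case by simp
    qed
  qed
  have \<Delta>: "\<Delta> \<subseteq> {0..T}"
    unfolding assms(15) using lower upper by fastforce
  have WI: "has_wiener_integral M T W (K u) (X u)" if "u \<in> {0..T}" for u
    using assms(8) that by blast
  have K: "square_integrable L2T (K u)" if "u \<in> {0..T}" for u
    using wiener_integralD(1)[OF WI[OF that]] .
  obtain F f where F: "\<And>n. F n \<in> linear_span K \<Delta>" and f: "square_integrable L2T f" "tendsto_L2 L2T F f"
    and orth: "\<And>u. u \<in> \<Delta> \<Longrightarrow> inner_L2 L2T (\<lambda>s. K t s - f s) (K u) = 0"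
    using L2T.L2_projection[of \<Delta> K "K t"] K t \<Delta> by blast
  have inner_eq: "inner_L2 L2T f (K u) = inner_L2 L2T (K t) (K u)" if "u \<in> \<Delta>" for u
    using orth[OF that] inner_L2_diff_left[OF K[OF t] f(1) K[of u]] that \<Delta> by auto
  have "fredholm_solution T K \<Delta> t f"
    using f(1) inner_eq by (simp add: fredholm_solution_def inner_L2_def)
  moreover have "orthogonal_to_kernel_complement T K \<Delta> f"
    unfolding orthogonal_to_kernel_complement_def
  proof (intro allI impI, elim conjE)
    fix g assume g: "square_integrable L2T g" and g_orth: "\<forall>u\<in>\<Delta>. (\<integral>s. g s * K u s \<partial>L2T) = 0"
    have "inner_L2 L2T (F n) g = 0" for n
    proof -
      obtain J c where J: "finite J" "J \<subseteq> \<Delta>" and F_eq: "F n = (\<lambda>s. \<Sum>u\<in>J. c u * K u s)"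
        using F[of n] by (auto simp: linear_span_def)
      have "inner_L2 L2T (F n) g = (\<Sum>u\<in>J. inner_L2 L2T (\<lambda>s. c u * K u s) g)"
        unfolding F_eq
        by (rule inner_L2_sum_left[OF square_integrable_cmult[OF K] g]) (use J \<Delta> in auto)
      also have "\<dots> = 0"
      proof (rule sum.neutral, rule ballI)
        fix u assume "u \<in> J"
        then have "inner_L2 L2T g (K u) = 0"
          using g_orth J by (auto simp: inner_L2_def)
        then show "inner_L2 L2T (\<lambda>s. c u * K u s) g = 0"
          by (simp add: inner_L2_cmult_left inner_L2_commute[of _ "K u"])
      qed
      finally show ?thesis .
    qed
    moreover have "square_integrable L2T (F n)" for n
      by (rule square_integrable_linear_span[OF K F]) (use \<Delta> in auto)
    ultimately have "inner_L2 L2T f g = 0"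
      using inner_L2_tendsto[OF _ f g] LIMSEQ_unique[of "\<lambda>_. 0::real"] by fastforce
    then show "(\<integral>s. f s * g s \<partial>L2T) = 0"
      by (simp add: inner_L2_def)
  qed
  moreover have "AE s in L2T. h s = f s"
    if h: "fredholm_solution T K \<Delta> t h" "orthogonal_to_kernel_complement T K \<Delta> h"
      and f': "orthogonal_to_kernel_complement T K \<Delta> f" for h
  proof -
    have si_h: "square_integrable L2T h"
      using h(1) by (simp add: fredholm_solution_def)
    define g where "g s = h s - f s" for s
    have g: "square_integrable L2T g"
      unfolding g_def[abs_def] by (rule square_integrable_diff[OF si_h f(1)])
    \<comment> \<open>Both solutions have the same inner products with every observed kernel
      section, so g is an admissible test function in the orthogonality conditions of h and of
      f.\<close>
    have "(\<integral>s. g s * K u s \<partial>L2T) = 0" if "u \<in> \<Delta>" for u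
    proof -
      have "inner_L2 L2T g (K u) = inner_L2 L2T h (K u) - inner_L2 L2T f (K u)"
        unfolding g_def[abs_def] by (rule inner_L2_diff_left[OF si_h f(1) K]) (use that \<Delta> in auto)
      also have "\<dots> = 0"
        using h(1) inner_eq[OF that] that by (simp add: fredholm_solution_def inner_L2_def)
      finally show ?thesis by (simp add: inner_L2_def)
    qed
    then have "inner_L2 L2T h g = 0" "inner_L2 L2T f g = 0"
      using h(2) f' g by (simp_all add: orthogonal_to_kernel_complement_def inner_L2_def)
    then have "inner_L2 L2T g g = 0"
      using inner_L2_diff_left[OF si_h f(1) g] by (simp add: g_def[abs_def])
    from inner_L2_self_eq_0_AE[OF g this] show ?thesis
      by (simp add: g_def)
  qed
  moreover have "has_wiener_integral M T W f (real_cond_exp M (sigma_generated M X \<Delta>) (X t))"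
    by (rule conditional_expectation_wiener[OF assms(3) WI \<Delta> t F f orth])
  ultimately show "\<exists>f. fredholm_solution T K \<Delta> t f \<and> orthogonal_to_kernel_complement T K \<Delta> f \<and>
    (\<forall>h. fredholm_solution T K \<Delta> t h \<and> orthogonal_to_kernel_complement T K \<Delta> h \<longrightarrow>
       (AE s in lebesgue_on {0..T}. h s = f s)) \<and>
    has_wiener_integral M T W f (real_cond_exp M (sigma_generated M X \<Delta>) (X t))"
    by blast
qed

end
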